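(* Let $C(\Phi_j,G)$, $j=1,2$, be two Boolean models on $\mathbb{R}^d$ with point processes of germs $\Phi_1,\Phi_2$, respectively, and a common distribution of the typical grain $G$. Assume that $\Phi_1,\Phi_2$ are simple and have locally finite moment measures. If $\Phi_1\le_{dcx}\Phi_2$, then $$\mathsf{P}\bigl(C(\Phi_1,G)\cap B=\emptyset\bigr)\le \mathsf{P}\bigl(C(\Phi_2,G)\cap B=\emptyset\bigr)$$ for all bounded Borel sets $B\subset\mathbb{R}^d$. Moreover, if $G$ is a fixed (deterministic) compact grain, then the same conclusion holds provided $\nu_1(B)\le\nu_2(B)$ for all bounded Borel sets $B\subset\mathbb{R}^d$, where $\nu_j(B)=\mathsf{P}(\Phi_j(B)=0)$ is the void probability of $\Phi_j$.
   Context: A point process on $\mathbb{R}^d$ is a random locally finite counting measure (identified with its set of atoms when simple); all point processes are assumed to have Radon mean measure. Given a point process $\Phi$ (germs) and the distribution of a random closed set $G$ (typical grain), the Boolean model is $C(\Phi,G)=\bigcup_{X_i\in\Phi}(X_i+G_i)$, where given $\Phi$ the $G_i$ are i.i.d. random closed sets distributed as $G$. All Boolean models are assumed to be locally finite: for every compact $K$, the expected number of germs $X_i$ with $(X_i+G_i)\cap K\ne\emptyset$ is finite. The $k$-th moment measure of $\Phi$ is determined by $\alpha^k(B_1\times\dots\times B_k)=\mathsf{E}\prod_{i=1}^k\Phi(B_i)$. A Lebesgue-measurable $f:\mathbb{R}^k\to\mathbb{R}$ is directionally convex ($dcx$) if for all $x,y,p,q\in\mathbb{R}^k$ with $p\le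 x\le q$, $p\le y\le q$ (coordinatewise) and $x+y=p+q$ one has $f(x)+f(y)\le f(p)+f(q)$. $\Phi_1\le_{dcx}\Phi_2$ means that for every $k\ge1$ and all bounded Borel $B_1,\dots,B_k\subset\mathbb{R}^d$, $\mathsf{E}f(\Phi_1(B_1),\dots,\Phi_1(B_k))\le\mathsf{E}f(\Phi_2(B_1),\dots,\Phi_2(B_k))$ for all $dcx$ functions $f$ for which both expectations are finite. *)

theory Defs
  imports "HOL-Probability.Probability" "HOL-Library.Extended_Nat"
begin

section \<open>Point processes\<close>

definition locally_finite_counting_measure :: "'a::euclidean_space measure \<Rightarrow> bool" where
  "locally_finite_counting_measure \<mu> \<longleftrightarrow>
     sets \<mu> = sets borel \<and>
     (\<forall>B\<in>sets borel. bounded B \<longrightarrow> (\<exists>n::nat. emeasure \<mu> B = of_nat n))"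

text \<open>The last assumption says that the mean measure is Radon.\<close>

locale point_process = prob_space M
  for M :: "'w measure" and \<Phi> :: "'w \<Rightarrow> 'a::euclidean_space measure" +
  assumes counting: "\<And>w. w \<in> space M \<Longrightarrow> locally_finite_counting_measure (\<Phi> w)"
    and count_measurable:
      "\<And>B. B \<in> sets borel \<Longrightarrow> (\<lambda>w. emeasure (\<Phi> w) B) \<in> borel_measurable M"
    and mean_measure_Radon:
      "\<And>K. compact K \<Longrightarrow> (\<integral>\<^sup>+ w. emeasure (\<Phi> w) K \<partial>M) < \<infinity>"

definition simple_point_process ::
    "'w measure \<Rightarrow> ('w \<Rightarrow> 'a::euclidean_space measure) \<Rightarrow> bool" where
  "simple_point_process M \<Phi> \<longleftrightarrow> (AE w in M. \<forall>x. emeasure (\<Phi> w) {x} \<le> 1)"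

definition void_probability ::
    "'w measure \<Rightarrow> ('w \<Rightarrow> 'a::euclidean_space measure) \<Rightarrow> 'a set \<Rightarrow> real" where
  "void_probability M \<Phi> B = measure M {w \<in> space M. emeasure (\<Phi> w) B = 0}"

text \<open>The \<open>k\<close>-th power of the space is modelled by \<open>{..<k} \<rightarrow>\<^sub>E UNIV\<close>.\<close>

definition is_moment_measure ::
    "'w measure \<Rightarrow> ('w \<Rightarrow> 'a::euclidean_space measure) \<Rightarrow> nat \<Rightarrow> (nat \<Rightarrow> 'a) measure \<Rightarrow> bool" where
  "is_moment_measure M \<Phi> k \<alpha> \<longleftrightarrow>
     sets \<alpha> = sets (\<Pi>\<^sub>M i\<in>{..<k}. (borel :: 'a measure)) \<and>
     (\<forall>B. (\<forall>i<k. B i \<in> sets borel) \<longrightarrow>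
        emeasure \<alpha> (PiE {..<k} B) = (\<integral>\<^sup>+ w. (\<Prod>i<k. emeasure (\<Phi> w) (B i)) \<partial>M))"

text \<open>A locally finite \<open>\<alpha>\<close> is uniquely determined by its values on boxes, so the existential
  quantifier is harmless.\<close>

definition locally_finite_moment_measures ::
    "'w measure \<Rightarrow> ('w \<Rightarrow> 'a::euclidean_space measure) \<Rightarrow> bool" where
  "locally_finite_moment_measures M \<Phi> \<longleftrightarrow>
     (\<forall>k\<ge>1. \<exists>\<alpha>. is_moment_measure M \<Phi> k \<alpha> \<and>
        (\<forall>A\<in>sets \<alpha>. (\<exists>r. A \<subseteq> PiE {..<k} (\<lambda>_. cball 0 r)) \<longrightarrow> emeasure \<alpha> A < \<infinity>))"


section \<open>Directionally convex ordering\<close>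

definition dcx :: "nat \<Rightarrow> ((nat \<Rightarrow> real) \<Rightarrow> real) \<Rightarrow> bool" where
  "dcx k f \<longleftrightarrow>
     f \<in> borel_measurable (completion (\<Pi>\<^sub>M i\<in>{..<k}. lborel)) \<and>
     (\<forall>x \<in> {..<k} \<rightarrow>\<^sub>E UNIV. \<forall>y \<in> {..<k} \<rightarrow>\<^sub>E UNIV. \<forall>p \<in> {..<k} \<rightarrow>\<^sub>E UNIV. \<forall>q \<in> {..<k} \<rightarrow>\<^sub>E UNIV.
        (\<forall>i<k. p i \<le> x i \<and> x i \<le> q i \<and> p i \<le> y i \<and> y i \<le> q i \<and> x i + y i = p i + q i) \<longrightarrow>
        f x + f y \<le> f p + f q)"

definition counts ::
    "('w \<Rightarrow> 'a::euclidean_space measure) \<Rightarrow> nat \<Rightarrow> (nat \<Rightarrow> 'a set) \<Rightarrow> 'w \<Rightarrow> nat \<Rightarrow> real" where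
  "counts \<Phi> k B w = (\<lambda>i\<in>{..<k}. measure (\<Phi> w) (B i))"

definition dcx_le ::
    "'v measure \<Rightarrow> ('v \<Rightarrow> 'a::euclidean_space measure) \<Rightarrow>
     'w measure \<Rightarrow> ('w \<Rightarrow> 'a measure) \<Rightarrow> bool" where
  "dcx_le M1 \<Phi>1 M2 \<Phi>2 \<longleftrightarrow>
     (\<forall>k\<ge>1. \<forall>B. (\<forall>i<k. B i \<in> sets borel \<and> bounded (B i)) \<longrightarrow>
        (\<forall>f. dcx k f \<longrightarrow>
           integrable M1 (\<lambda>w. f (counts \<Phi>1 k B w)) \<longrightarrow>
           integrable M2 (\<lambda>w. f (counts \<Phi>2 k B w)) \<longrightarrow>
           (\<integral>w. f (counts \<Phi>1 k B w) \<partial>M1) \<le> (\<integral>w. f (counts \<Phi>2 k B w) \<partial>M2)))"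


section \<open>Boolean models\<close>

text \<open>The space of closed sets with the Borel \<open>\<sigma>\<close>-algebra of the Fell topology (the Effros
  \<open>\<sigma>\<close>-algebra), which is generated by the events that a compact set is hit. The empty set is
  a closed set.\<close>

definition closed_sets_space :: "'a::euclidean_space set measure" where
  "closed_sets_space =
     sigma {F. closed F} {{F. closed F \<and> F \<inter> K \<noteq> {}} | K. compact K}"

text \<open>\<open>Q\<close> is the distribution of the typical grain. The germs are enumerated (with multiplicity)
  as \<open>X i\<close> for \<open>i < N\<close>, where \<open>N\<close> may be infinite, and the grain attached to \<open>X i\<close>
  is \<open>G i\<close>; the \<open>X i\<close> and \<open>G i\<close> with \<open>i \<ge> N\<close> play no role. Conditionally on the germs the grains
  are i.i.d. with law \<open>Q\<close>: the \<open>G i\<close> are i.i.d. with law \<open>Q\<close> and the sequence \<open>G\<close> is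
  independent of the enumerated germs.\<close>

locale boolean_model = point_process M \<Phi>
  for M :: "'w measure" and \<Phi> :: "'w \<Rightarrow> 'a::euclidean_space measure"
    and Q :: "'a set measure" and N :: "'w \<Rightarrow> enat"
    and X :: "nat \<Rightarrow> 'w \<Rightarrow> 'a" and G :: "nat \<Rightarrow> 'w \<Rightarrow> 'a set" +
  assumes number_measurable: "N \<in> measurable M (count_space UNIV)"
    and germ_measurable: "\<And>i. X i \<in> borel_measurable M"
    and germs: "\<And>w B. w \<in> space M \<Longrightarrow> B \<in> sets borel \<Longrightarrow>
      emeasure (\<Phi> w) B = emeasure (count_space UNIV) {i. enat i < N w \<and> X i w \<in> B}"
    and grain_measurable: "\<And>i. G i \<in> measurable M closed_sets_space"
    and grain_distribution: "\<And>i. distr M closed_sets_space (G i) = Q"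
    and grains_independent: "indep_vars (\<lambda>_. closed_sets_space) G UNIV"
    and grains_independent_of_germs:
      "indep_set
         (sets (vimage_algebra (space M) (\<lambda>w. (N w, \<lambda>i. X i w))
            (count_space UNIV \<Otimes>\<^sub>M (\<Pi>\<^sub>M i\<in>UNIV. (borel :: 'a measure)))))
         (sets (vimage_algebra (space M) (\<lambda>w i. G i w)
            (\<Pi>\<^sub>M i\<in>UNIV. (closed_sets_space :: 'a set measure))))"
    and locally_finite: "\<And>K. compact K \<Longrightarrow>
      (\<integral>\<^sup>+ w. emeasure (count_space UNIV)
                {i. enat i < N w \<and> (+) (X i w) ` G i w \<inter> K \<noteq> {}} \<partial>M) < \<infinity>"

definition boolean_set ::
    "('w \<Rightarrow> enat) \<Rightarrow> (nat \<Rightarrow> 'w \<Rightarrow> 'a::euclidean_space) \<Rightarrow> (nat \<Rightarrow> 'w \<Rightarrow> 'a set) \<Rightarrow> 'w \<Rightarrow> 'a set" where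
  "boolean_set N X G w = (\<Union>i\<in>{i. enat i < N w}. (+) (X i w) ` G i w)"

text \<open>For a Borel set \<open>B\<close> the event below is universally measurable (by Choquet's capacity
  theorem) but in general not in \<open>sets M\<close>, hence the completion.\<close>

definition avoidance_probability ::
    "'w measure \<Rightarrow> ('w \<Rightarrow> 'a set) \<Rightarrow> 'a set \<Rightarrow> real" where
  "avoidance_probability M C B = measure (completion M) {w \<in> space M. C w \<inter> B = {}}"

end

theory Submission
  imports Defs
begin

text \<open>For compact \<open>K\<close> put \<open>p x = Q {F. (x + F) \<inter> K \<noteq> {}}\<close>. Conditionally on the germs the grains miss
  \<open>K\<close> independently, so \<open>C \<inter> K = {}\<close> has probability \<open>E exp (- \<integral> h d\<Phi>)\<close> with
  \<open>h = - ln (1 - p)\<close>. When \<open>h\<close> is a simple function of bounded support, the integrand is the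
  dcx function \<open>x \<mapsto> exp (- (a\<^sub>1 x\<^sub>1 + \<dots> + a\<^sub>k x\<^sub>k))\<close>, \<open>a\<^sub>i \<ge> 0\<close>, of the counts of
  \<open>\<Phi>\<close> in its level sets; monotone limits give the inequality for all \<open>h\<close>. For a fixed grain
  \<open>G0\<close> the event says that \<open>\<Phi>\<close> has no point in \<open>K - G0\<close>. A bounded Borel set \<open>B\<close> is
  analytic, and the outer probability that the random closed set \<open>C\<close> hits a set is a capacity, so
  Choquet's argument makes hitting \<open>B\<close> measurable in the completion and approximates its
  probability by those of hitting compact subsets of \<open>B\<close>.\<close>

section \<open>Analytic sets\<close>

text \<open>With the product of discrete topologies \<open>nat \<Rightarrow> nat\<close> is Baire
  space, so these are the Souslin sets, written as projections of closed sets. A sequence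
  \<open>f\<close> with \<open>(f, x) \<in> Z\<close> serves as a code of \<open>x\<close>.\<close>

definition analytic :: "'a::topological_space set \<Rightarrow> bool" where
  "analytic A \<longleftrightarrow> (\<exists>Z :: ((nat \<Rightarrow> nat) \<times> 'a) set. closed Z \<and> A = snd ` Z)"

lemma analytic_closed: "closed A \<Longrightarrow> analytic A"
  unfolding analytic_def
  by (rule exI[of _ "UNIV \<times> A"]) (auto intro: closed_Times)

text \<open>Each coordinate of the image is again a coordinate projection. The cases of interest are
  the shift \<open>r = Suc\<close> and the reading of one row of a double sequence.\<close>

lemma continuous_on_reindex_Pair:
  "continuous_on UNIV (\<lambda>z :: (nat \<Rightarrow> nat) \<times> 'a::topological_space. ((\<lambda>k. fst z (r k)), snd z))"
proof (intro continuous_on_Pair continuous_on_coordinatewise_then_product continuous_intros)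
  fix k
  have "continuous_on UNIV ((\<lambda>x. x (r k)) \<circ> (fst :: (nat \<Rightarrow> nat) \<times> 'a \<Rightarrow> _))"
    by (intro continuous_on_compose continuous_intros continuous_on_subset[OF continuous_on_product_coordinates]) auto
  then show "continuous_on UNIV (\<lambda>z :: (nat \<Rightarrow> nat) \<times> 'a. fst z (r k))" by (simp add: comp_def)
qed

text \<open>The first entry of a code names the index \<open>n\<close> and the remaining entries
  form a code for \<open>Z n\<close>. As fixing the first entry is an open condition, the complement
  of the combined set \<open>W\<close> is a union of open sets.\<close>

lemma analytic_UN:
  fixes A :: "nat \<Rightarrow> 'a::topological_space set"
  assumes "\<And>n. analytic (A n)"
  shows "analytic (\<Union>n. A n)"
proof -
  obtain Z :: "nat \<Rightarrow> ((nat \<Rightarrow> nat) \<times> 'a) set" where Z: "\<And>n. closed (Z n)" "\<And>n. A n = snd ` Z n"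
    using assms unfolding analytic_def by metis
  define W where "W = {z. ((\<lambda>k. fst z (Suc k)), snd z) \<in> Z (fst z 0)}"
  have op: "open {z :: (nat \<Rightarrow> nat) \<times> 'a. fst z 0 = n}" for n
  proof -
    have "open ({f :: nat \<Rightarrow> nat. \<forall>i\<in>{0}. f i \<in> {n}} \<times> (UNIV :: 'a set))"
      by (intro open_Times product_topology_basis') (auto intro!: Topological_Spaces.open_discrete)
    also have "{f :: nat \<Rightarrow> nat. \<forall>i\<in>{0}. f i \<in> {n}} \<times> (UNIV :: 'a set) = {z. fst z 0 = n}"
      by auto
    finally show ?thesis .
  qed
  have "- W = (\<Union>n. {z. fst z 0 = n} \<inter> (\<lambda>z. ((\<lambda>k. fst z (Suc k)), snd z)) -` (- Z n))"
    by (auto simp: W_def)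
  moreover have "open \<dots>"
    using Z(1) by (intro open_UN ballI open_Int op open_vimage continuous_on_reindex_Pair) auto
  ultimately have "closed W" by (metis open_closed double_complement)
  moreover have "(\<Union>n. A n) = snd ` W"
  proof (intro equalityI subsetI)
    fix x assume "x \<in> (\<Union>n. A n)"
    then obtain n f where "(f, x) \<in> Z n" by (auto simp: Z(2))
    then have "(case_nat n f, x) \<in> W" by (simp add: W_def)
    then show "x \<in> snd ` W" by force
  next
    fix x assume "x \<in> snd ` W"
    then obtain f where "(f, x) \<in> W" by auto
    then have "((\<lambda>k. f (Suc k)), x) \<in> Z (f 0)" by (simp add: W_def)
    then show "x \<in> (\<Union>n. A n)" unfolding Z(2) by force
  qed
  ultimately show ?thesis unfolding analytic_def by blast
qed

text \<open>A single sequence stores countably many codes through the pairing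
  \<open>prod_encode\<close>; its row \<open>n\<close> is required to be a code for
  \<open>Z n\<close>, which is a closed condition for each \<open>n\<close>.\<close>

lemma analytic_INT:
  fixes A :: "nat \<Rightarrow> 'a::topological_space set"
  assumes "\<And>n. analytic (A n)"
  shows "analytic (\<Inter>n. A n)"
proof -
  obtain Z :: "nat \<Rightarrow> ((nat \<Rightarrow> nat) \<times> 'a) set" where Z: "\<And>n. closed (Z n)" "\<And>n. A n = snd ` Z n"
    using assms unfolding analytic_def by metis
  define W where "W = (\<Inter>n. (\<lambda>z. ((\<lambda>k. fst z (prod_encode (n, k))), snd z)) -` Z n)"
  have "closed W"
    unfolding W_def using Z(1)
    by (intro closed_INT ballI closed_vimage continuous_on_reindex_Pair) auto
  moreover have "(\<Inter>n. A n) = snd ` W"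
  proof (intro equalityI subsetI)
    fix x assume "x \<in> (\<Inter>n. A n)"
    then have "\<forall>n. \<exists>f. (f, x) \<in> Z n" by (force simp: Z(2))
    then obtain f where f: "\<And>n. (f n, x) \<in> Z n" by metis
    have "((\<lambda>m. f (fst (prod_decode m)) (snd (prod_decode m))), x) \<in> W" by (simp add: W_def f)
    then show "x \<in> snd ` W" by force
  next
    fix x assume "x \<in> snd ` W"
    then obtain f where "(f, x) \<in> W" by auto
    then have "((\<lambda>k. f (prod_encode (n, k))), x) \<in> Z n" for n by (auto simp: W_def)
    then show "x \<in> (\<Inter>n. A n)" unfolding Z(2) by force
  qed
  ultimately show ?thesis unfolding analytic_def by blast
qed

text \<open>Analytic sets are not closed under complements, so the induction over the sigma-algebra
  carries the claim for a set together with its complement. Complements of closed sets are handled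
  as countable unions of compact sets.\<close>

lemma analytic_borel:
  fixes B :: "'a::euclidean_space set"
  assumes "B \<in> sets borel"
  shows "analytic B"
proof -
  have "B \<in> sigma_sets UNIV {S. closed S}"
    using assms by (simp add: borel_eq_closed)
  then have "analytic B \<and> analytic (- B)"
  proof (induction rule: sigma_sets.induct)
    case (Basic S)
    then have "open (- S)" by auto
    then obtain F :: "nat \<Rightarrow> 'a set" where F: "\<And>n. compact (F n)" "(\<Union>n. F n) = - S"
      by (metis open_Union_compact_subsets)
    have "analytic (\<Union>n. F n)"
      by (intro analytic_UN analytic_closed compact_imp_closed F(1))
    then show ?case using Basic F(2) by (simp add: analytic_closed)
  next
    case Empty
    then show ?case by (auto intro: analytic_closed)
  next
    case (Compl S)
    then show ?case by (simp add: Compl_eq_Diff_UNIV[symmetric])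
  next
    case (Union A)
    then show ?case by (simp add: analytic_UN analytic_INT Compl_UN)
  qed
  then show ?thesis ..
qed

section \<open>Compactness in Baire space\<close>

lemma tendsto_fun_discrete:
  fixes f :: "nat \<Rightarrow> nat \<Rightarrow> nat"
  shows "f \<longlonglongrightarrow> g \<longleftrightarrow> (\<forall>i. \<forall>\<^sub>F n in sequentially. f n i = g i)"
proof -
  have "f \<longlonglongrightarrow> g \<longleftrightarrow> limitin (product_topology (\<lambda>i. euclidean) UNIV) f g sequentially"
    by (simp add: euclidean_product_topology)
  also have "\<dots> \<longleftrightarrow> (\<forall>i. (\<lambda>n. f n i) \<longlonglongrightarrow> g i)"
    by (simp add: limitin_componentwise)
  finally show ?thesis by (simp add: tendsto_discrete)
qed

text \<open>By Tychonoff, as a product of the finite sets \<open>{..m i}\<close>.\<close>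

lemma compact_fun_bounded: "compact {f :: nat \<Rightarrow> nat. \<forall>i. f i \<le> m i}"
proof -
  have "compactin (product_topology (\<lambda>i. euclidean) UNIV) (PiE UNIV (\<lambda>i. {..m i}))"
    by (subst compactin_PiE) (auto intro: finite_imp_compact)
  moreover have "PiE UNIV (\<lambda>i. {..m i}) = {f :: nat \<Rightarrow> nat. \<forall>i. f i \<le> m i}" by (auto simp: PiE_def)
  ultimately show ?thesis by (simp add: euclidean_product_topology)
qed

text \<open>A point of all the closures is a limit of points \<open>y n\<close> whose codes
  \<open>f n\<close> respect the bound \<open>m\<close> on their first \<open>n\<close> entries.
  Compactness of the sequences below \<open>m\<close> yields a limit code along a subsequence, and
  \<open>Z\<close> is closed.\<close>

lemma INT_closure_truncation_subset:
  fixes Z :: "((nat \<Rightarrow> nat) \<times> 'a::metric_space) set"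
  assumes "closed Z"
  shows "(\<Inter>n. closure (snd ` (Z \<inter> {z. \<forall>i<n. fst z i \<le> m i}))) \<subseteq> snd ` Z"
proof
  fix x assume x: "x \<in> (\<Inter>n. closure (snd ` (Z \<inter> {z. \<forall>i<n. fst z i \<le> m i})))"
  have "\<exists>f y. (f, y) \<in> Z \<and> (\<forall>i<n. f i \<le> m i) \<and> dist y x < inverse (real (Suc n))" for n
  proof -
    have "x \<in> closure (snd ` (Z \<inter> {z. \<forall>i<n. fst z i \<le> m i}))" using x by blast
    moreover have "0 < inverse (real (Suc n))" by simp
    ultimately obtain y where "y \<in> snd ` (Z \<inter> {z. \<forall>i<n. fst z i \<le> m i})"
      "dist y x < inverse (real (Suc n))"
      unfolding closure_approachable by blast
    then show ?thesis by force
  qed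
  then obtain f y where fy: "\<And>n. (f n, y n) \<in> Z" "\<And>n i. i < n \<Longrightarrow> f n i \<le> m i"
    "\<And>n. dist (y n) x < inverse (real (Suc n))"
    by metis
  \<comment> \<open>Capping by \<open>m\<close> moves the codes into a compact set and alters only
    entries with index at least \<open>n\<close>. At a fixed coordinate, \<open>f n\<close> and
    \<open>g n\<close> therefore agree from some \<open>n\<close> on.\<close>
  define g where "g n = (\<lambda>i. min (f n i) (m i))" for n
  have "\<forall>n. g n \<in> {f. \<forall>i. f i \<le> m i}" by (simp add: g_def)
  from seq_compactE[OF compact_imp_seq_compact[OF compact_fun_bounded[of m]] this]
  obtain l r where lr: "strict_mono (r :: nat \<Rightarrow> nat)" "(g \<circ> r) \<longlonglongrightarrow> l" .
  have "(f \<circ> r) \<longlonglongrightarrow> l"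
    unfolding tendsto_fun_discrete
  proof
    fix i
    have "\<forall>\<^sub>F n in sequentially. (g \<circ> r) n i = l i"
      using lr(2) unfolding tendsto_fun_discrete by blast
    moreover have "\<forall>\<^sub>F n in sequentially. i < n" by (rule eventually_gt_at_top)
    ultimately show "\<forall>\<^sub>F n in sequentially. (f \<circ> r) n i = l i"
    proof eventually_elim
      case (elim n)
      then have "i < r n" using seq_suble[OF lr(1), of n] by simp
      then show ?case using elim fy(2)[of i "r n"] by (simp add: g_def)
    qed
  qed
  moreover have "y \<longlonglongrightarrow> x"
    by (rule metric_tendsto_imp_tendsto[OF LIMSEQ_inverse_real_of_nat])
       (use fy(3) in \<open>auto intro!: always_eventually less_imp_le\<close>)
  then have "(y \<circ> r) \<longlonglongrightarrow> x" using lr(1) by (rule LIMSEQ_subseq_LIMSEQ)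
  ultimately have "(\<lambda>n. ((f \<circ> r) n, (y \<circ> r) n)) \<longlonglongrightarrow> (l, x)" by (rule tendsto_Pair)
  then have "(l, x) \<in> Z"
    by (rule closed_sequentially[OF assms, rotated]) (simp add: fy(1))
  then show "x \<in> snd ` Z" by force
qed

section \<open>Hitting events of a random closed set\<close>

text \<open>Choquet's argument: bounds on the entries of the codes are chosen one after another so
  that the outer probability of hitting stays above \<open>t\<close>. The closures of the resulting
  sets decrease to a compact \<open>K \<subseteq> B\<close>, and continuity from above carries the
  bound over to \<open>K\<close>.\<close>

lemma (in prob_space) hitting_capacitability:
  fixes F :: "'a \<Rightarrow> 'b::euclidean_space set"
  assumes cl: "AE w in M. closed (F w)"
    and meas: "\<And>K. compact K \<Longrightarrow> {w \<in> space M. F w \<inter> K \<noteq> {}} \<in> events"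
    and B: "B \<in> sets borel" "bounded B"
    and t: "t < outer_measure_of M {w \<in> space M. F w \<inter> B \<noteq> {}}"
  obtains K where "compact K" "K \<subseteq> B" "t \<le> emeasure M {w \<in> space M. F w \<inter> K \<noteq> {}}"
proof -
  define H where "H A = {w \<in> space M. F w \<inter> A \<noteq> {}}" for A
  obtain Z :: "((nat \<Rightarrow> nat) \<times> 'b) set" where Z: "closed Z" "B = snd ` Z"
    using analytic_borel[OF B(1)] unfolding analytic_def by blast
  \<comment> \<open>\<open>T n m\<close> is the part of \<open>B\<close> that has a code whose first
    \<open>n\<close> entries are bounded by \<open>m\<close>; \<open>T 0 m\<close> is
    \<open>B\<close> itself.\<close>
  define T where "T n m = snd ` (Z \<inter> {z. \<forall>i<n. fst z i \<le> m i})" for n and m :: "nat \<Rightarrow> nat"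
  have T_sub: "T n m \<subseteq> B" for n m by (auto simp: T_def Z)
  \<comment> \<open>Stage \<open>n\<close> fixes the bound on entry \<open>n\<close> and keeps the
    earlier ones.\<close>
  have "\<exists>g. \<forall>n. t < outer_measure_of M (H (T n (g n))) \<and> (\<forall>i<n. g (Suc n) i = g n i)"
  proof (rule dependent_nat_choice)
    show "\<exists>m. t < outer_measure_of M (H (T 0 m))"
      using t by (simp add: T_def Z H_def)
  next
    fix m n assume *: "t < outer_measure_of M (H (T n m))"
    have T_Suc: "T n m = (\<Union>k. T (Suc n) (m(n := k)))"
    proof (intro equalityI subsetI)
      fix x assume "x \<in> T n m"
      then obtain f where f: "(f, x) \<in> Z" "\<forall>i<n. f i \<le> m i" by (auto simp: T_def)
      then have "x \<in> T (Suc n) (m(n := f n))" by (force simp: T_def less_Suc_eq)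
      then show "x \<in> (\<Union>k. T (Suc n) (m(n := k)))" by blast
    qed (force simp: T_def less_Suc_eq)
    have "incseq (\<lambda>k. H (T (Suc n) (m(n := k))))"
    proof (rule incseq_SucI)
      fix k
      have "T (Suc n) (m(n := k)) \<subseteq> T (Suc n) (m(n := Suc k))"
        by (force simp: T_def less_Suc_eq)
      then show "H (T (Suc n) (m(n := k))) \<subseteq> H (T (Suc n) (m(n := Suc k)))"
        by (auto simp: H_def)
    qed
    \<comment> \<open>Outer measures are continuous along arbitrary increasing sequences of sets, so
      the hitting sets need not be events here.\<close>
    then have "(SUP k. outer_measure_of M (H (T (Suc n) (m(n := k)))))
      = outer_measure_of M (\<Union>k. H (T (Suc n) (m(n := k))))"
      by (rule SUP_outer_measure_of_incseq[rotated]) (auto simp: H_def)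
    also have "(\<Union>k. H (T (Suc n) (m(n := k)))) = H (T n m)"
      unfolding T_Suc by (auto simp: H_def)
    finally have "t < (SUP k. outer_measure_of M (H (T (Suc n) (m(n := k)))))"
      using * by (simp only:)
    then obtain k where "t < outer_measure_of M (H (T (Suc n) (m(n := k))))"
      by (auto simp: less_SUP_iff)
    then show "\<exists>m'. t < outer_measure_of M (H (T (Suc n) m')) \<and> (\<forall>i<n. m' i = m i)"
      by (intro exI[of _ "m(n := k)"]) auto
  qed
  then obtain g where g: "\<And>n. t < outer_measure_of M (H (T n (g n)))"
    "\<And>n i. i < n \<Longrightarrow> g (Suc n) i = g n i" by blast
  \<comment> \<open>The diagonal of the stages: entry \<open>i\<close> is final from stage
    \<open>Suc i\<close> on, and \<open>T n\<close> depends only on the first \<open>n\<close>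
    bounds.\<close>
  define m where "m i = g (Suc i) i" for i
  have "g n i = m i" if "i < n" for n i
    using that
  proof (induction n)
    case (Suc n)
    then show ?case by (cases "i = n") (auto simp: m_def g(2))
  qed simp
  then have T_m: "T n (g n) = T n m" for n by (force simp: T_def)
  define K where "K = (\<Inter>n. closure (T n m))"
  have cpt: "compact (closure (T n m))" for n
    using bounded_subset[OF B(2) T_sub] by (simp add: compact_closure)
  have dec: "closure (T n m) \<subseteq> closure (T k m)" if "k \<le> n" for k n
    using that by (intro closure_mono) (force simp: T_def)
  have H_cl: "H (closure (T n m)) \<in> events" for n
    unfolding H_def by (rule meas[OF cpt])
  have "compact K" unfolding K_def using cpt by (intro compact_Inter) auto
  moreover have "K \<subseteq> B"
    unfolding K_def T_def Z(2) by (rule INT_closure_truncation_subset[OF Z(1)])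
  moreover have "t \<le> emeasure M (H K)"
  proof -
    \<comment> \<open>If \<open>F w\<close> is closed and meets every closure, then the
      intersections are nested nonempty compact sets and have a common point. Closedness holds
      almost surely, hence so does the equality of the two events.\<close>
    have "emeasure M (H K) = emeasure M (\<Inter>n. H (closure (T n m)))"
    proof (rule emeasure_eq_AE)
      show "AE w in M. (w \<in> H K) = (w \<in> (\<Inter>n. H (closure (T n m))))"
      proof (rule AE_mp[OF cl AE_I2], rule impI)
        fix w assume "w \<in> space M" and elim: "closed (F w)"
        have "F w \<inter> K \<noteq> {}" if "\<forall>n. F w \<inter> closure (T n m) \<noteq> {}"
        proof -
          have "\<Inter> (range (\<lambda>n. F w \<inter> closure (T n m))) \<noteq> {}"
            by (intro compact_nest closed_Int_compact[OF elim cpt]) (use that dec in blast)+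
          then show ?thesis by (auto simp: K_def)
        qed
        then show "(w \<in> H K) = (w \<in> (\<Inter>n. H (closure (T n m))))"
          using \<open>w \<in> space M\<close> unfolding H_def K_def by blast
      qed
      show "H K \<in> events" unfolding H_def by (rule meas[OF \<open>compact K\<close>])
      show "(\<Inter>n. H (closure (T n m))) \<in> events"
        using H_cl by (intro sets.countable_INT) auto
    qed
    also have "\<dots> = (INF n. emeasure M (H (closure (T n m))))"
    proof (rule INF_emeasure_decseq[symmetric])
      show "decseq (\<lambda>n. H (closure (T n m)))"
        unfolding decseq_def H_def using dec by blast
    qed (use H_cl in auto)
    \<comment> \<open>Passing from \<open>T n m\<close> to its closure enlarges the hitting set and
      turns it into an event, where outer measure and measure agree.\<close>
    also have "t \<le> \<dots>"
    proof (rule INF_greatest)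
      fix n
      have "t \<le> outer_measure_of M (H (T n m))" using g(1)[of n] by (simp add: T_m)
      also have "\<dots> \<le> outer_measure_of M (H (closure (T n m)))"
        using closure_subset[of "T n m"] unfolding H_def by (intro outer_measure_of_mono) blast
      also have "\<dots> = emeasure M (H (closure (T n m)))"
        by (rule outer_measure_of_eq[OF H_cl])
      finally show "t \<le> emeasure M (H (closure (T n m)))" .
    qed
    finally show ?thesis .
  qed
  ultimately show thesis unfolding H_def by (rule that)
qed

text \<open>The hitting set of \<open>B\<close> lies between a countable union \<open>U\<close> of
  hitting events of compact subsets and a measurable hull \<open>V\<close>. Capacitability makes
  their probabilities equal, so the gap \<open>V - U\<close> is a null set.\<close>

lemma (in prob_space) hitting_completion:
  fixes F :: "'a \<Rightarrow> 'b::euclidean_space set"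
  assumes cl: "AE w in M. closed (F w)"
    and meas: "\<And>K. compact K \<Longrightarrow> {w \<in> space M. F w \<inter> K \<noteq> {}} \<in> events"
    and B: "B \<in> sets borel" "bounded B"
  shows "{w \<in> space M. F w \<inter> B \<noteq> {}} \<in> sets (completion M)"
    and "\<And>e. 0 < e \<Longrightarrow> \<exists>K. compact K \<and> K \<subseteq> B \<and>
      measure (completion M) {w \<in> space M. F w \<inter> B \<noteq> {}} \<le> prob {w \<in> space M. F w \<inter> K \<noteq> {}} + e"
proof -
  define H where "H A = {w \<in> space M. F w \<inter> A \<noteq> {}}" for A
  have H: "H K \<in> events" if "compact K" for K unfolding H_def using that by (rule meas)
  have mono: "H A \<subseteq> H B" if "A \<subseteq> B" for A B using that by (auto simp: H_def)
  obtain V where V: "V \<in> events" "H B \<subseteq> V" "outer_measure_of M (H B) = emeasure M V"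
    using outer_measure_of_attain[of "H B" M] by (auto simp: H_def)
  have appr: "\<exists>K. compact K \<and> K \<subseteq> B \<and> prob V - e \<le> prob (H K)" if "0 < e" for e
  \<comment> \<open>A negative level would be truncated to \<open>0\<close> by
    \<open>ennreal\<close> and the strict inequality required for capacitability could fail; the
    empty set serves in that case.\<close>
  proof (cases "prob V - e < 0")
    case True
    then have "prob V - e \<le> prob (H {})" by (rule less_imp_le[OF less_le_trans]) simp
    then show ?thesis by (intro exI[of _ "{}"]) auto
  next
    case False
    then have "ennreal (prob V - e) < outer_measure_of M (H B)"
      using that by (simp add: V(3) emeasure_eq_measure ennreal_less_iff)
    from hitting_capacitability[OF cl meas B this[unfolded H_def]]
    obtain K where "compact K" "K \<subseteq> B" "ennreal (prob V - e) \<le> emeasure M (H K)"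
      unfolding H_def .
    then show ?thesis
      using False by (auto simp: emeasure_eq_measure)
  qed
  then have "\<forall>n. \<exists>K. compact K \<and> K \<subseteq> B \<and> prob V - inverse (real (Suc n)) \<le> prob (H K)"
    by simp
  then obtain K where K: "\<And>n. compact (K n)" "\<And>n. K n \<subseteq> B"
    "\<And>n. prob V - inverse (real (Suc n)) \<le> prob (H (K n))" by metis
  define U where "U = (\<Union>n. H (K n))"
  have U: "U \<in> events" "U \<subseteq> H B"
    using H[OF K(1)] mono[OF K(2)] by (auto simp: U_def)
  have "prob V \<le> prob U"
  proof (rule LIMSEQ_le_const2)
    show "(\<lambda>n. prob V - inverse (real (Suc n))) \<longlonglongrightarrow> prob V"
      using tendsto_diff[OF tendsto_const LIMSEQ_inverse_real_of_nat, of "prob V"] by simp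
    show "\<exists>N. \<forall>n\<ge>N. prob V - inverse (real (Suc n)) \<le> prob U"
    proof (intro exI[of _ 0] allI impI)
      fix n
      have "prob (H (K n)) \<le> prob U"
        using U(1) by (intro finite_measure_mono) (auto simp: U_def)
      with K(3)[of n] show "prob V - inverse (real (Suc n)) \<le> prob U" by simp
    qed
  qed
  then have "prob (V - U) = 0"
    using finite_measure_Diff[OF V(1) U(1)] U V measure_nonneg[of M "V - U"] by auto
  then have null: "V - U \<in> null_sets M"
    using U V by (auto simp: null_sets_def emeasure_eq_measure)
  have meas_B: "H B \<in> sets (completion M)"
    by (rule sets_completionI[of _ U "H B - U" "V - U"]) (use null U V in auto)
  then show "{w \<in> space M. F w \<inter> B \<noteq> {}} \<in> sets (completion M)" by (simp add: H_def)
  have "measure (completion M) (H B) \<le> measure (completion M) V"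
    using V meas_B by (intro finite_measure.finite_measure_mono)
      (auto intro!: finite_measureI)
  also have "\<dots> = prob V" using V(1) by simp
  finally have le: "measure (completion M) (H B) \<le> prob V" .
  fix e :: real assume "0 < e"
  from appr[OF this] obtain K where "compact K" "K \<subseteq> B" "prob V - e \<le> prob (H K)" by blast
  with le show "\<exists>K. compact K \<and> K \<subseteq> B \<and>
      measure (completion M) {w \<in> space M. F w \<inter> B \<noteq> {}} \<le> prob {w \<in> space M. F w \<inter> K \<noteq> {}} + e"
    unfolding H_def by (intro exI[of _ K] conjI) simp_all
qed

section \<open>Laplace functionals and the directionally convex order\<close>

text \<open>\<open>enn2real top = 0\<close>, hence the case distinction.\<close>

definition enexp :: "ennreal \<Rightarrow> real" where
  "enexp a = (if a = top then 0 else exp (- enn2real a))"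

lemma enexp_nonneg: "0 \<le> enexp a" and enexp_le_1: "enexp a \<le> 1"
  by (auto simp: enexp_def)

lemma enexp_0 [simp]: "enexp 0 = 1"
  by (simp add: enexp_def)

lemma enexp_ennreal: "0 \<le> x \<Longrightarrow> enexp (ennreal x) = exp (- x)"
  by (simp add: enexp_def)

lemma measurable_enexp [measurable]: "enexp \<in> borel_measurable borel"
  unfolding enexp_def by measurable

lemma enexp_add: "enexp (a + b) = enexp a * enexp b"
  by (cases a; cases b) (auto simp: enexp_def ennreal_plus[symmetric] exp_add[symmetric] simp del: ennreal_plus)

lemma enexp_sum: "enexp (\<Sum>i\<in>I. f i) = (\<Prod>i\<in>I. enexp (f i))"
  by (induction I rule: infinite_finite_induct) (auto simp: enexp_add)

text \<open>At a finite limit \<open>f\<close> is eventually finite and \<open>enexp\<close> is the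
  usual exponential. Continuity at \<open>top\<close> is what admits germs that hit with probability
  one.\<close>

lemma tendsto_enexp:
  assumes "(f \<longlongrightarrow> l) F"
  shows "((\<lambda>x. enexp (f x)) \<longlongrightarrow> enexp l) F"
proof (cases l)
  case (real r)
  have "eventually (\<lambda>x. f x < top) F"
    by (rule order_tendstoD(2)[OF assms]) (simp add: real)
  then have ev: "eventually (\<lambda>x. exp (- enn2real (f x)) = enexp (f x)) F"
    by eventually_elim (auto simp: enexp_def)
  have "((\<lambda>x. exp (- enn2real (f x))) \<longlongrightarrow> exp (- r)) F"
    using assms real by (intro tendsto_intros tendsto_enn2real) auto
  then show ?thesis
    using ev real by (auto simp: enexp_def intro: Lim_transform_eventually)
next
  case top
  have "((\<lambda>x. enexp (f x)) \<longlongrightarrow> 0) F"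
  proof (rule order_tendstoI)
    fix e :: real assume "0 < e"
    \<comment> \<open>Any \<open>r > c\<close> satisfies \<open>exp (- r) < e\<close>; the maximum
      with \<open>0\<close> prevents \<open>ennreal\<close> from truncating
      \<open>c\<close>.\<close>
    define c where "c = max 0 (- ln e)"
    have c: "0 \<le> c" "- ln e \<le> c" by (auto simp: c_def)
    have "eventually (\<lambda>x. ennreal c < f x) F"
      by (rule order_tendstoD(1)[OF assms]) (simp add: top)
    then show "eventually (\<lambda>x. enexp (f x) < e) F"
    proof eventually_elim
      case (elim x)
      show ?case
      proof (cases "f x")
        case (real r)
        then have "c < r" using elim c by (simp add: ennreal_less_iff)
        then have "- r < ln e" using c by simp
        then have "exp (- r) < e" using \<open>0 < e\<close> by (metis exp_less_cancel_iff exp_ln)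
        then show ?thesis using real by (simp add: enexp_def)
      qed (use \<open>0 < e\<close> in \<open>simp add: enexp_def\<close>)
    qed
  qed (auto intro!: always_eventually less_le_trans[OF _ enexp_nonneg])
  then show ?thesis using top by (simp add: enexp_def)
qed

text \<open>The difference of the two sides factors as
  \<open>exp (- p) * (1 - exp (p - x)) * (1 - exp (p - y))\<close>, where
  \<open>exp (p - x - y) = exp (- q)\<close>.\<close>

lemma exp_minus_quadrilateral:
  fixes p q x y :: real
  assumes "p \<le> x" "p \<le> y" "x + y = p + q"
  shows "exp (- x) + exp (- y) \<le> exp (- p) + exp (- q)"
proof -
  have "0 \<le> exp (- p) * ((1 - exp (p - x)) * (1 - exp (p - y)))"
    using assms by (intro mult_nonneg_nonneg) auto
  also have "\<dots> = exp (- p) + exp (- p) * exp (p - x) * exp (p - y)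
      - exp (- p) * exp (p - x) - exp (- p) * exp (p - y)"
    by (simp add: algebra_simps)
  also have "\<dots> = exp (- p) + exp (- q) - exp (- x) - exp (- y)"
    using assms(3) by (simp add: exp_add[symmetric] algebra_simps)
  finally show ?thesis by simp
qed

text \<open>A linear form with nonnegative coefficients preserves the order relations and the
  identity \<open>x + y = p + q\<close>, which reduces the claim to one dimension.\<close>

lemma dcx_exp_minus_linear:
  assumes a: "\<And>i. i < k \<Longrightarrow> 0 \<le> a i"
  shows "dcx k (\<lambda>z. exp (- (\<Sum>i<k. a i * z i)))"
  unfolding dcx_def
proof (intro conjI ballI impI)
  have "(\<lambda>z. exp (- (\<Sum>i<k. a i * z i))) \<in> borel_measurable (\<Pi>\<^sub>M i\<in>{..<k}. lborel)"
    by measurable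
  then show "(\<lambda>z. exp (- (\<Sum>i<k. a i * z i))) \<in> borel_measurable (completion (\<Pi>\<^sub>M i\<in>{..<k}. lborel))"
    by (rule measurable_completion)
next
  fix x y p q :: "nat \<Rightarrow> real"
  assume *: "\<forall>i<k. p i \<le> x i \<and> x i \<le> q i \<and> p i \<le> y i \<and> y i \<le> q i \<and> x i + y i = p i + q i"
  show "exp (- (\<Sum>i<k. a i * x i)) + exp (- (\<Sum>i<k. a i * y i))
    \<le> exp (- (\<Sum>i<k. a i * p i)) + exp (- (\<Sum>i<k. a i * q i))"
    using * a by (intro exp_minus_quadrilateral sum_mono mult_left_mono)
      (auto simp: sum.distrib[symmetric] distrib_left[symmetric])
qed

section \<open>Integrals with respect to a point process and their Laplace functionals\<close>

context point_process
begin

lemma sets_Phi: "w \<in> space M \<Longrightarrow> sets (\<Phi> w) = sets borel"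
  using counting[of w] by (simp add: locally_finite_counting_measure_def)

lemma emeasure_Phi_bounded:
  assumes "w \<in> space M" "B \<in> sets borel" "bounded B"
  shows "emeasure (\<Phi> w) B = ennreal (measure (\<Phi> w) B)"
proof -
  have "emeasure (\<Phi> w) B \<noteq> top"
    using assms counting[of w] unfolding locally_finite_counting_measure_def
    by (metis ennreal_of_nat_neq_top)
  then show ?thesis by (rule emeasure_eq_ennreal_measure)
qed

lemma nn_integral_Phi_simple:
  assumes "w \<in> space M" "simple_function borel f" "C \<in> sets borel"
  shows "(\<integral>\<^sup>+ x. f x * indicator C x \<partial>\<Phi> w) = (\<Sum>y\<in>range f. y * emeasure (\<Phi> w) (f -` {y} \<inter> C))"
proof -
  have sp: "space (\<Phi> w) = UNIV" using sets_eq_imp_space_eq[OF sets_Phi[OF assms(1)]] by simp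
  have f: "simple_function (\<Phi> w) f"
    using assms(2) sp by (simp add: simple_function_def sets_Phi[OF assms(1)])
  have C: "C \<in> sets (\<Phi> w)" using assms by (simp add: sets_Phi)
  have "(\<integral>\<^sup>+ x. f x * indicator C x \<partial>\<Phi> w) = integral\<^sup>S (\<Phi> w) (\<lambda>x. f x * indicator C x)"
    using f C by (intro nn_integral_eq_simple_integral) auto
  also have "\<dots> = (\<Sum>y\<in>range f. y * emeasure (\<Phi> w) (f -` {y} \<inter> C))"
    using simple_integral_indicator[OF C f] sp by (simp add: Int_commute)
  finally show ?thesis .
qed

text \<open>The integral is the sum of the values of \<open>f\<close>, enumerated by
  \<open>y\<close>, weighted with the counts of their level sets in \<open>C\<close>. Finiteness of
  \<open>f\<close> and boundedness of \<open>C\<close> ensure that the passage to real numbers loses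
  nothing.\<close>

lemma enexp_nn_integral_simple:
  assumes w: "w \<in> space M" and f: "simple_function borel f" "\<And>x. f x < top"
    and C: "C \<in> sets borel" "bounded C" and y: "bij_betw y {..<k} (range f)"
  shows "enexp (\<integral>\<^sup>+ x. f x * indicator C x \<partial>\<Phi> w)
    = exp (- (\<Sum>i<k. enn2real (y i) * counts \<Phi> k (\<lambda>i. f -` {y i} \<inter> C) w i))"
proof -
  define a where "a i = enn2real (y i)" for i
  define B where "B i = f -` {y i} \<inter> C" for i
  have B: "B i \<in> sets borel" "bounded (B i)" for i
    using simple_functionD(2)[OF f(1)] C by (auto simp: B_def intro: bounded_subset)
  have ya: "y i = ennreal (a i)" if "i < k" for i
  proof -
    have "y i \<in> range f" using y that by (auto simp: bij_betw_def)
    then show ?thesis using f(2) by (auto simp: a_def)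
  qed
  have a: "0 \<le> a i" for i by (simp add: a_def)
  have "(\<integral>\<^sup>+ x. f x * indicator C x \<partial>\<Phi> w) = (\<Sum>i<k. y i * emeasure (\<Phi> w) (B i))"
    unfolding nn_integral_Phi_simple[OF w f(1) C(1)] B_def
    by (rule sum.reindex_bij_betw[OF y, symmetric])
  also have "\<dots> = (\<Sum>i<k. ennreal (a i * measure (\<Phi> w) (B i)))"
    by (intro sum.cong) (simp_all add: emeasure_Phi_bounded[OF w B] ya a ennreal_mult)
  also have "\<dots> = ennreal (\<Sum>i<k. a i * measure (\<Phi> w) (B i))"
    by (rule sum_ennreal) (simp add: a)
  finally have "enexp (\<integral>\<^sup>+ x. f x * indicator C x \<partial>\<Phi> w) = exp (- (\<Sum>i<k. a i * measure (\<Phi> w) (B i)))"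
    by (simp add: enexp_ennreal sum_nonneg a)
  then show ?thesis by (simp add: a_def B_def counts_def)
qed

text \<open>Measurability is assumed for the counts of Borel sets only; simple functions and a
  supremum extend it to integrals.\<close>

lemma measurable_nn_integral_Phi:
  assumes h: "h \<in> borel_measurable borel"
  shows "(\<lambda>w. \<integral>\<^sup>+ x. h x \<partial>\<Phi> w) \<in> borel_measurable M"
proof -
  obtain f where f: "\<And>n. simple_function borel (f n)" "incseq f" "\<And>x. (SUP n. f n x) = h x"
    using borel_measurable_implies_simple_function_sequence'[OF h] by metis
  have "(\<integral>\<^sup>+ x. h x \<partial>\<Phi> w) = (SUP n. \<Sum>y\<in>range (f n). y * emeasure (\<Phi> w) (f n -` {y}))"
    if w: "w \<in> space M" for w
  proof -
    have "(\<integral>\<^sup>+ x. h x \<partial>\<Phi> w) = (\<integral>\<^sup>+ x. (SUP n. f n x) \<partial>\<Phi> w)" by (simp add: f(3))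
    also have "\<dots> = (SUP n. \<integral>\<^sup>+ x. f n x \<partial>\<Phi> w)"
      using f(1) by (intro nn_integral_monotone_convergence_SUP f(2))
        (auto simp: measurable_cong_sets[OF sets_Phi[OF w]] intro: borel_measurable_simple_function)
    also have "\<dots> = (SUP n. \<Sum>y\<in>range (f n). y * emeasure (\<Phi> w) (f n -` {y}))"
      using nn_integral_Phi_simple[OF w f(1), of UNIV] by simp
    finally show ?thesis .
  qed
  moreover have "(\<lambda>w. SUP n. \<Sum>y\<in>range (f n). y * emeasure (\<Phi> w) (f n -` {y})) \<in> borel_measurable M"
  proof -
    have [measurable]: "(\<lambda>w. emeasure (\<Phi> w) (f n -` {y})) \<in> borel_measurable M" for n y
      using simple_functionD(2)[OF f(1), of n "{y}"] by (intro count_measurable) simp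
    show ?thesis by measurable
  qed
  ultimately show ?thesis by (simp cong: measurable_cong)
qed

lemma integrable_enexp:
  assumes "f \<in> borel_measurable M"
  shows "integrable M (\<lambda>w. enexp (f w))"
  using assms by (intro integrable_const_bound[of _ 1]) (auto simp: enexp_nonneg enexp_le_1)

text \<open>Monotone convergence applies to each realisation of the process, and dominated
  convergence to the expectation, because \<open>enexp\<close> takes values between 0 and 1.\<close>

lemma tendsto_laplace:
  assumes f: "\<And>n. f n \<in> borel_measurable borel" "incseq f" "\<And>x. (SUP n. f n x) = h x"
  shows "(\<lambda>n. \<integral>w. enexp (\<integral>\<^sup>+ x. f n x \<partial>\<Phi> w) \<partial>M) \<longlonglongrightarrow> (\<integral>w. enexp (\<integral>\<^sup>+ x. h x \<partial>\<Phi> w) \<partial>M)"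
proof (rule integral_dominated_convergence[where w = "\<lambda>_. 1"])
  have h: "h \<in> borel_measurable borel" unfolding f(3)[symmetric] using f(1) by (intro borel_measurable_SUP) auto
  show "(\<lambda>w. enexp (\<integral>\<^sup>+ x. h x \<partial>\<Phi> w)) \<in> borel_measurable M"
    using measurable_nn_integral_Phi[OF h] by measurable
  show "(\<lambda>w. enexp (\<integral>\<^sup>+ x. f n x \<partial>\<Phi> w)) \<in> borel_measurable M" for n
    using measurable_nn_integral_Phi[OF f(1)] by measurable
  show "AE w in M. (\<lambda>n. enexp (\<integral>\<^sup>+ x. f n x \<partial>\<Phi> w)) \<longlonglongrightarrow> enexp (\<integral>\<^sup>+ x. h x \<partial>\<Phi> w)"
  proof (intro AE_I2 tendsto_enexp)
    fix w assume w: "w \<in> space M"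
    have "(\<integral>\<^sup>+ x. h x \<partial>\<Phi> w) = (\<integral>\<^sup>+ x. (SUP n. f n x) \<partial>\<Phi> w)" by (simp add: f(3))
    also have "\<dots> = (SUP n. \<integral>\<^sup>+ x. f n x \<partial>\<Phi> w)"
      using f(1) by (intro nn_integral_monotone_convergence_SUP f(2))
        (simp add: measurable_cong_sets[OF sets_Phi[OF w]])
    finally show "(\<lambda>n. \<integral>\<^sup>+ x. f n x \<partial>\<Phi> w) \<longlonglongrightarrow> (\<integral>\<^sup>+ x. h x \<partial>\<Phi> w)"
      using f(2) by (auto intro!: LIMSEQ_SUP nn_integral_mono simp: incseq_def le_fun_def)
  qed
qed (auto simp: enexp_nonneg enexp_le_1)

end

section \<open>Comparison of Laplace functionals under the dcx order\<close>

lemma dcx_le_laplace_simple: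
  assumes P1: "point_process M1 \<Phi>1" and P2: "point_process M2 \<Phi>2" and le: "dcx_le M1 \<Phi>1 M2 \<Phi>2"
    and f: "simple_function borel f" "\<And>x. f x < top" and C: "C \<in> sets borel" "bounded C"
  shows "(\<integral>w. enexp (\<integral>\<^sup>+ x. f x * indicator C x \<partial>\<Phi>1 w) \<partial>M1)
    \<le> (\<integral>w. enexp (\<integral>\<^sup>+ x. f x * indicator C x \<partial>\<Phi>2 w) \<partial>M2)"
proof -
  interpret P1: point_process M1 \<Phi>1 by (rule P1)
  interpret P2: point_process M2 \<Phi>2 by (rule P2)
  have fin: "finite (range f)" using f(1) by (simp add: simple_function_def)
  define k where "k = card (range f)"
  have k: "1 \<le> k" using fin by (simp add: k_def Suc_le_eq card_gt_0_iff)
  obtain y where y: "bij_betw y {..<k} (range f)"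
    using ex_bij_betw_nat_finite[OF fin] by (auto simp: k_def atLeast0LessThan)
  define a where "a i = enn2real (y i)" for i
  define B where "B i = f -` {y i} \<inter> C" for i
  define L where "L = (\<lambda>z :: nat \<Rightarrow> real. exp (- (\<Sum>i<k. a i * z i)))"
  have B: "B i \<in> sets borel" "bounded (B i)" for i
    using simple_functionD(2)[OF f(1)] C by (auto simp: B_def intro: bounded_subset)
  \<comment> \<open>The order compares only finite expectations; they are finite here because
    \<open>enexp\<close> is bounded.\<close>
  have int1: "integrable M1 (\<lambda>w. enexp (\<integral>\<^sup>+ x. f x * indicator C x \<partial>\<Phi>1 w))"
    and int2: "integrable M2 (\<lambda>w. enexp (\<integral>\<^sup>+ x. f x * indicator C x \<partial>\<Phi>2 w))"
    using f(1) C by (intro P1.integrable_enexp P1.measurable_nn_integral_Phi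
        P2.integrable_enexp P2.measurable_nn_integral_Phi;
        auto intro!: borel_measurable_times borel_measurable_simple_function)+
  have eq1: "enexp (\<integral>\<^sup>+ x. f x * indicator C x \<partial>\<Phi>1 w) = L (counts \<Phi>1 k B w)" if "w \<in> space M1" for w
    unfolding L_def a_def B_def by (rule P1.enexp_nn_integral_simple[OF that f C y])
  have eq2: "enexp (\<integral>\<^sup>+ x. f x * indicator C x \<partial>\<Phi>2 w) = L (counts \<Phi>2 k B w)" if "w \<in> space M2" for w
    unfolding L_def a_def B_def by (rule P2.enexp_nn_integral_simple[OF that f C y])
  have "integrable M1 (\<lambda>w. L (counts \<Phi>1 k B w))" "integrable M2 (\<lambda>w. L (counts \<Phi>2 k B w))"
    using int1 int2 by (simp_all add: eq1 eq2 cong: Bochner_Integration.integrable_cong)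
  moreover have "dcx k L" unfolding L_def by (rule dcx_exp_minus_linear) (simp add: a_def)
  ultimately have "(\<integral>w. L (counts \<Phi>1 k B w) \<partial>M1) \<le> (\<integral>w. L (counts \<Phi>2 k B w) \<partial>M2)"
    using le k B unfolding dcx_le_def by blast
  then show ?thesis
    by (simp add: eq1 eq2 cong: Bochner_Integration.integral_cong)
qed

lemma dcx_le_laplace:
  assumes P1: "point_process M1 \<Phi>1" and P2: "point_process M2 \<Phi>2" and le: "dcx_le M1 \<Phi>1 M2 \<Phi>2"
    and h: "h \<in> borel_measurable borel"
  shows "(\<integral>w. enexp (\<integral>\<^sup>+ x. h x \<partial>\<Phi>1 w) \<partial>M1) \<le> (\<integral>w. enexp (\<integral>\<^sup>+ x. h x \<partial>\<Phi>2 w) \<partial>M2)"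
proof -
  interpret P1: point_process M1 \<Phi>1 by (rule P1)
  interpret P2: point_process M2 \<Phi>2 by (rule P2)
  obtain f where f: "\<And>n. simple_function borel (f n)" "incseq f" "\<And>n x. f n x < top" "\<And>x. (SUP n. f n x) = h x"
    using borel_measurable_implies_simple_function_sequence'[OF h] by metis
  \<comment> \<open>The order speaks of bounded sets only, so the simple functions are cut off to
    balls that exhaust the space.\<close>
  define g where "g n x = f n x * indicator (cball 0 (real n)) x" for n x
  have g: "g n \<in> borel_measurable borel" for n
    unfolding g_def using f(1) by (auto intro!: borel_measurable_times borel_measurable_simple_function)
  have inc: "incseq g"
    using f(2) by (auto simp: incseq_def le_fun_def g_def indicator_def)
  have lim: "(SUP n. g n x) = h x" for x
  proof (rule antisym)
    show "(SUP n. g n x) \<le> h x"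
      unfolding f(4)[symmetric] by (rule SUP_mono) (auto simp: g_def indicator_def)
    obtain m :: nat where m: "norm x \<le> real m" using real_arch_simple by blast
    show "h x \<le> (SUP n. g n x)"
      unfolding f(4)[symmetric]
    proof (rule SUP_mono)
      fix n
      have "f n x \<le> f (max n m) x" using f(2) by (auto simp: incseq_def le_fun_def)
      also have "\<dots> = g (max n m) x" using m by (simp add: g_def indicator_def)
      finally show "\<exists>m\<in>UNIV. f n x \<le> g m x" by blast
    qed
  qed
  show ?thesis
    using P1.tendsto_laplace[OF g inc lim] P2.tendsto_laplace[OF g inc lim]
  proof (rule LIMSEQ_le)
    show "\<exists>N. \<forall>n\<ge>N. (\<integral>w. enexp (\<integral>\<^sup>+ x. g n x \<partial>\<Phi>1 w) \<partial>M1) \<le> (\<integral>w. enexp (\<integral>\<^sup>+ x. g n x \<partial>\<Phi>2 w) \<partial>M2)"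
      unfolding g_def using f by (intro exI allI impI dcx_le_laplace_simple[OF P1 P2 le]) auto
  qed
qed

section \<open>The avoidance functional of a Boolean model\<close>

lemma space_closed_sets_space: "space closed_sets_space = {F. closed F}"
  unfolding closed_sets_space_def by (rule space_measure_of) auto

lemma hit_in_closed_sets_space:
  "compact K \<Longrightarrow> {F. closed F \<and> F \<inter> K \<noteq> {}} \<in> sets closed_sets_space"
  unfolding closed_sets_space_def by (subst sets_measure_of) auto

section \<open>Hitting of a compact set by a translated grain\<close>

definition translate_hits :: "'a::euclidean_space set \<Rightarrow> 'a \<Rightarrow> 'a set set" where
  "translate_hits K x = {F. closed F \<and> (+) x ` F \<inter> K \<noteq> {}}"

text \<open>Replacing \<open>x\<close> by a nearby point \<open>q\<close> of a countable set and thickening \<open>K - q\<close> accordingly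
  exhibits the hitting relation as a countable combination of measurable rectangles.\<close>

lemma translate_hits_approx:
  fixes K :: "'a::euclidean_space set"
  assumes K: "compact K" and D: "\<forall>X. open X \<longrightarrow> X \<noteq> {} \<longrightarrow> (\<exists>d\<in>D. d \<in> X)"
  shows "F \<in> translate_hits K x \<longleftrightarrow>
    (\<forall>n::nat. \<exists>q\<in>D. dist x q < 1 / real (Suc n) \<and> closed F \<and>
      F \<inter> (\<lambda>(k, v). k - q + v) ` (K \<times> cball 0 (1 / real (Suc n))) \<noteq> {})"
    (is "_ \<longleftrightarrow> (\<forall>n. ?P n)")
proof
  assume "F \<in> translate_hits K x"
  then obtain f where f: "closed F" "f \<in> F" "x + f \<in> K" by (auto simp: translate_hits_def)
  show "\<forall>n. ?P n"
  proof
    fix n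
    obtain q where q: "q \<in> D" "dist x q < 1 / real (Suc n)"
      using D[rule_format, of "ball x (1 / real (Suc n))"] by auto
    have "f = (\<lambda>(k, v). k - q + v) (x + f, q - x)" by simp
    moreover have "(x + f, q - x) \<in> K \<times> cball 0 (1 / real (Suc n))"
      using f q by (simp add: dist_norm norm_minus_commute)
    ultimately have "f \<in> (\<lambda>(k, v). k - q + v) ` (K \<times> cball 0 (1 / real (Suc n)))"
      by (rule image_eqI)
    then show "?P n" using f q by blast
  qed
next
  assume *: "\<forall>n. ?P n"
  then have F: "closed F" by blast
  show "F \<in> translate_hits K x"
  proof (rule ccontr)
    assume "F \<notin> translate_hits K x"
    then have "K \<inter> (+) x ` F = {}" using F by (auto simp: translate_hits_def)
    then obtain d where d: "0 < d" "\<And>k y. k \<in> K \<Longrightarrow> y \<in> (+) x ` F \<Longrightarrow> d \<le> dist k y"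
      using separate_compact_closed[OF K closed_translation[OF F, of x]] by blast
    \<comment> \<open>One half of \<open>2 / real (Suc n)\<close> pays for replacing
      \<open>x\<close> by \<open>q\<close>, the other for the thickening \<open>v\<close>.\<close>
    obtain n where n: "2 / real (Suc n) < d"
      using reals_Archimedean[of "d / 2"] d(1) by (auto simp: field_simps)
    obtain q k v where q: "dist x q < 1 / real (Suc n)" "k \<in> K" "norm v \<le> 1 / real (Suc n)" "k - q + v \<in> F"
      using *[rule_format, of n] by auto
    then have "d \<le> dist k (x + (k - q + v))" by (intro d(2)) auto
    also have "\<dots> = norm ((x - q) + v)" by (simp add: dist_norm norm_minus_commute algebra_simps)
    also have "\<dots> \<le> norm (x - q) + norm v" by (rule norm_triangle_ineq)
    also have "\<dots> \<le> 2 / real (Suc n)" using q by (simp add: dist_norm field_simps)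
    finally show False using n by simp
  qed
qed

text \<open>Joint measurability is the point: germ and grain are both random, and the hitting
  probability has to be measurable in the germ. The rectangles are measurable since each thickened
  set \<open>C n q\<close> is compact.\<close>

lemma translate_hits_measurable:
  fixes K :: "'a::euclidean_space set"
  assumes K: "compact K"
  shows "{z. snd z \<in> translate_hits K (fst z)} \<in> sets (borel \<Otimes>\<^sub>M closed_sets_space)"
proof -
  obtain D :: "'a set" where D: "countable D" "\<forall>X. open X \<longrightarrow> X \<noteq> {} \<longrightarrow> (\<exists>d\<in>D. d \<in> X)"
    by (rule countable_dense_setE) blast
  define C where "C n q = (\<lambda>(k, v). k - q + v) ` (K \<times> cball 0 (1 / real (Suc n)))" for n and q :: 'a
  have C: "compact (C n q)" for n q
    unfolding C_def split_def using K
    by (intro compact_continuous_image compact_Times compact_cball continuous_intros)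
  have "{z. snd z \<in> translate_hits K (fst z)}
    = (\<Inter>n. \<Union>q\<in>D. ball q (1 / real (Suc n)) \<times> {F. closed F \<and> F \<inter> C n q \<noteq> {}})"
    by (rule set_eqI) (simp only: translate_hits_approx[OF K D(2)] C_def mem_Collect_eq INT_iff UN_iff
        mem_Times_iff mem_ball dist_commute ball_UNIV)
  also have "\<dots> \<in> sets (borel \<Otimes>\<^sub>M closed_sets_space)"
  proof -
    have "(\<Union>q\<in>D. ball q (1 / real (Suc n)) \<times> {F. closed F \<and> F \<inter> C n q \<noteq> {}})
        \<in> sets (borel \<Otimes>\<^sub>M closed_sets_space)" for n
      using pair_measureI[OF borel_open[OF open_ball] hit_in_closed_sets_space[OF C]]
      by (intro sets.countable_UN'[OF D(1)]) auto
    then show ?thesis by (intro sets.countable_INT) auto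
  qed
  finally show ?thesis .
qed

lemma translate_hits_sets:
  "compact K \<Longrightarrow> translate_hits K x \<in> sets closed_sets_space"
  using sets_Pair1[OF translate_hits_measurable, of K x] by simp

text \<open>Chosen so that \<open>enexp (hazard Q K x) = 1 - p\<close>, which turns the product of
  missing probabilities over the germs into an integral against the process. The case
  \<open>p = 1\<close> is separate, because \<open>ln 0\<close> does not stand for minus
  infinity.\<close>

definition hazard :: "'a::euclidean_space set measure \<Rightarrow> 'a set \<Rightarrow> 'a \<Rightarrow> ennreal" where
  "hazard Q K x = (let p = measure Q (translate_hits K x) in
     if 1 \<le> p then top else ennreal (- ln (1 - p)))"

context boolean_model
begin

lemma prob_space_Q: "prob_space Q"
  using prob_space_distr[OF grain_measurable[of 0]] by (simp add: grain_distribution)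

lemma sets_Q [simp, measurable_cong]: "sets Q = sets closed_sets_space"
  using grain_distribution[of 0] by (metis sets_distr)

lemma grain_closed: "w \<in> space M \<Longrightarrow> closed (G i w)"
  using measurable_space[OF grain_measurable, of w i] by (simp add: space_closed_sets_space)

lemma enexp_hazard: "enexp (hazard Q K x) = 1 - measure Q (translate_hits K x)"
proof -
  interpret Q: prob_space Q by (rule prob_space_Q)
  have p: "0 \<le> Q.prob (translate_hits K x)" "Q.prob (translate_hits K x) \<le> 1" by auto
  show ?thesis
    using p antisym[OF p(2)] by (auto simp: hazard_def enexp_def Let_def)
qed

lemma measurable_hit_probability:
  assumes "compact K"
  shows "(\<lambda>x. measure Q (translate_hits K x)) \<in> borel_measurable borel"
proof -
  interpret Q: prob_space Q by (rule prob_space_Q)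
  have "{z. snd z \<in> translate_hits K (fst z)} \<in> sets (borel \<Otimes>\<^sub>M Q)"
    using translate_hits_measurable[OF assms] by (simp cong: sets_pair_measure_cong)
  from Q.measurable_emeasure_Pair[OF this]
  show ?thesis unfolding measure_def by (simp add: vimage_def)
qed

lemma measurable_hazard:
  assumes "compact K"
  shows "hazard Q K \<in> borel_measurable borel"
  unfolding hazard_def Let_def using measurable_hit_probability[OF assms] by measurable

text \<open>The measure \<open>\<Phi> w\<close> is the image under \<open>i \<mapsto> X i w\<close>
  of counting measure on the indices below \<open>N w\<close>.\<close>

lemma nn_integral_germs:
  assumes w: "w \<in> space M" and h: "h \<in> borel_measurable borel"
  shows "(\<integral>\<^sup>+ x. h x \<partial>\<Phi> w) = (\<Sum>i. if enat i < N w then h (X i w) else 0)"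
proof -
  let ?I = "{i. enat i < N w}"
  have "\<Phi> w = distr (count_space ?I) borel (\<lambda>i. X i w)"
  proof (rule measure_eqI)
    fix B assume "B \<in> sets (\<Phi> w)"
    then have B: "B \<in> sets borel" by (simp add: sets_Phi[OF w])
    have "{i. enat i < N w \<and> X i w \<in> B} = (\<lambda>i. X i w) -` B \<inter> ?I" by auto
    then show "emeasure (\<Phi> w) B = emeasure (distr (count_space ?I) borel (\<lambda>i. X i w)) B"
      using B by (simp add: germs[OF w B] emeasure_distr emeasure_count_space)
  qed (simp add: sets_Phi[OF w])
  then have "(\<integral>\<^sup>+ x. h x \<partial>\<Phi> w) = (\<integral>\<^sup>+ i. h (X i w) \<partial>count_space ?I)"
    using h by (simp add: nn_integral_distr)
  also have "\<dots> = (\<integral>\<^sup>+ i. (if enat i < N w then h (X i w) else 0) \<partial>count_space UNIV)"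
    by (subst nn_integral_count_space_indicator) (auto intro!: nn_integral_cong simp: indicator_def)
  finally show ?thesis by (simp add: nn_integral_count_space_nat)
qed

section \<open>Hitting events and closedness of the Boolean model\<close>

lemma hit_event:
  assumes K: "compact K"
  shows "{w \<in> space M. enat i < N w \<and> (+) (X i w) ` G i w \<inter> K \<noteq> {}} \<in> events"
proof -
  have [measurable]: "(\<lambda>w. (X i w, G i w)) \<in> M \<rightarrow>\<^sub>M borel \<Otimes>\<^sub>M closed_sets_space"
    using germ_measurable[of i] grain_measurable[of i] by measurable
  have [measurable]: "(\<lambda>w. N w) \<in> M \<rightarrow>\<^sub>M count_space UNIV" by (rule number_measurable)
  have "{w \<in> space M. enat i < N w \<and> (+) (X i w) ` G i w \<inter> K \<noteq> {}}
    = {w \<in> space M. enat i < N w} \<inter> ((\<lambda>w. (X i w, G i w)) -` {z. snd z \<in> translate_hits K (fst z)} \<inter> space M)"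
    using grain_closed by (auto simp: translate_hits_def)
  also have "\<dots> \<in> events"
    by (intro sets.Int measurable_sets[OF _ translate_hits_measurable[OF K]]; measurable)
  finally show ?thesis .
qed

lemma boolean_set_hits_iff:
  "boolean_set N X G w \<inter> B \<noteq> {} \<longleftrightarrow> (\<exists>i. enat i < N w \<and> (+) (X i w) ` G i w \<inter> B \<noteq> {})"
  unfolding boolean_set_def by blast

lemma boolean_set_hit_event:
  assumes K: "compact K"
  shows "{w \<in> space M. boolean_set N X G w \<inter> K \<noteq> {}} \<in> events"
proof -
  have "{w \<in> space M. boolean_set N X G w \<inter> K \<noteq> {}}
    = (\<Union>i. {w \<in> space M. enat i < N w \<and> (+) (X i w) ` G i w \<inter> K \<noteq> {}})"
    unfolding boolean_set_hits_iff by blast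
  also have "\<dots> \<in> events" using hit_event[OF K] by blast
  finally show ?thesis .
qed

text \<open>Local finiteness makes the expected number of hits finite. That number is measurable as
  a series of indicators of hitting events, so it is finite almost surely.\<close>

lemma AE_finite_hits:
  assumes K: "compact K"
  shows "AE w in M. finite {i. enat i < N w \<and> (+) (X i w) ` G i w \<inter> K \<noteq> {}}"
proof -
  let ?I = "\<lambda>w. {i. enat i < N w \<and> (+) (X i w) ` G i w \<inter> K \<noteq> {}}"
  have eq: "emeasure (count_space UNIV) (?I w) = (\<Sum>i. if i \<in> ?I w then 1 else 0)" for w
  proof -
    have "emeasure (count_space UNIV) (?I w) = (\<integral>\<^sup>+ i. indicator (?I w) i \<partial>count_space UNIV)"
      by (rule nn_integral_indicator[symmetric]) simp
    then show ?thesis by (simp only: nn_integral_count_space_nat indicator_def of_bool_def)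
  qed
  have "(\<lambda>w. emeasure (count_space UNIV) (?I w)) \<in> borel_measurable M"
    unfolding eq using hit_event[OF K]
    by (intro borel_measurable_suminf_order measurable_If) simp_all
  from nn_integral_PInf_AE[OF this]
  have "AE w in M. emeasure (count_space UNIV) (?I w) \<noteq> \<infinity>"
    using locally_finite[OF K] by simp
  then show ?thesis
  proof eventually_elim
    case (elim w)
    then show ?case by (cases "finite (?I w)") (auto simp: emeasure_count_space)
  qed
qed

text \<open>Outside one null set, every ball is met by finitely many translated grains. A convergent
  sequence in the union is bounded, hence stays in a finite union of closed sets, which contains its
  limit.\<close>

lemma AE_closed_boolean_set: "AE w in M. closed (boolean_set N X G w)"
proof -
  have "AE w in M. \<forall>n::nat. finite {i. enat i < N w \<and> (+) (X i w) ` G i w \<inter> cball 0 (real n) \<noteq> {}}"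
    unfolding AE_all_countable by (intro allI AE_finite_hits compact_cball)
  then show ?thesis
    using AE_space
  proof eventually_elim
    case (elim w)
    show ?case
      unfolding closed_sequential_limits
    proof (intro allI impI, elim conjE)
      fix x l assume x: "\<forall>n. x n \<in> boolean_set N X G w" and lim: "x \<longlonglongrightarrow> l"
      then have "Bseq x" using convergentI convergent_imp_Bseq by blast
      then obtain r where r: "\<And>n. norm (x n) \<le> r" unfolding Bseq_def by blast
      obtain m :: nat where m: "r \<le> real m" using real_arch_simple by blast
      let ?J = "{i. enat i < N w \<and> (+) (X i w) ` G i w \<inter> cball 0 (real m) \<noteq> {}}"
      have "closed (\<Union>i\<in>?J. (+) (X i w) ` G i w)"
        using elim grain_closed by (intro closed_UN ballI closed_translation) auto
      moreover have "x n \<in> (\<Union>i\<in>?J. (+) (X i w) ` G i w)" for n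
      proof -
        obtain i where i: "enat i < N w" "x n \<in> (+) (X i w) ` G i w"
          using x unfolding boolean_set_def by blast
        moreover have "x n \<in> cball 0 (real m)" using r[of n] m by simp
        ultimately have "i \<in> ?J" by blast
        then show ?thesis using i(2) by blast
      qed
      ultimately have "l \<in> (\<Union>i\<in>?J. (+) (X i w) ` G i w)"
        using lim by (rule closed_sequentially)
      then show "l \<in> boolean_set N X G w" unfolding boolean_set_def by blast
    qed
  qed
qed

end

text \<open>The library's \<open>indep_var\<close> requires both random variables to have the same value type.\<close>

lemma (in prob_space) distr_Pair_indep_set:
  assumes U: "U \<in> M \<rightarrow>\<^sub>M S" and V: "V \<in> M \<rightarrow>\<^sub>M T"
    and indep: "indep_set (sets (vimage_algebra (space M) U S)) (sets (vimage_algebra (space M) V T))"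
  shows "distr M (S \<Otimes>\<^sub>M T) (\<lambda>w. (U w, V w)) = distr M S U \<Otimes>\<^sub>M distr M T V"
proof (rule pair_measure_eqI[symmetric])
  interpret U: prob_space "distr M S U" by (rule prob_space_distr[OF U])
  interpret V: prob_space "distr M T V" by (rule prob_space_distr[OF V])
  show "sigma_finite_measure (distr M S U)" "sigma_finite_measure (distr M T V)" by unfold_locales
  show "sets (distr M S U \<Otimes>\<^sub>M distr M T V) = sets (distr M (S \<Otimes>\<^sub>M T) (\<lambda>w. (U w, V w)))"
    by (simp cong: sets_pair_measure_cong)
  fix A B assume "A \<in> sets (distr M S U)" "B \<in> sets (distr M T V)"
  then have A: "A \<in> sets S" and B: "B \<in> sets T" by simp_all
  have UV: "(\<lambda>w. (U w, V w)) \<in> M \<rightarrow>\<^sub>M S \<Otimes>\<^sub>M T" using U V by (rule measurable_Pair)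
  have "prob ((U -` A \<inter> space M) \<inter> (V -` B \<inter> space M)) = prob (U -` A \<inter> space M) * prob (V -` B \<inter> space M)"
    using indep_setD[OF indep in_vimage_algebra[OF A] in_vimage_algebra[OF B]] .
  also have "(U -` A \<inter> space M) \<inter> (V -` B \<inter> space M) = (\<lambda>w. (U w, V w)) -` (A \<times> B) \<inter> space M"
    by auto
  finally show "emeasure (distr M S U) A * emeasure (distr M T V) B
      = emeasure (distr M (S \<Otimes>\<^sub>M T) (\<lambda>w. (U w, V w))) (A \<times> B)"
    by (simp add: emeasure_distr[OF U A] emeasure_distr[OF V B] emeasure_distr[OF UV pair_measureI[OF A B]]
        emeasure_eq_measure ennreal_mult[symmetric])
qed

section \<open>Averaging over the grains given the germs\<close>

context boolean_model
begin

lemma grain_hits_iff: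
  "w \<in> space M \<Longrightarrow> G i w \<in> translate_hits K x \<longleftrightarrow> (+) x ` G i w \<inter> K \<noteq> {}"
  by (simp add: translate_hits_def grain_closed)

lemma prob_grains_miss:
  assumes K: "compact K" and J: "finite J"
  shows "prob {w \<in> space M. \<forall>i\<in>J. (+) (x i) ` G i w \<inter> K = {}}
    = (\<Prod>i\<in>J. 1 - measure Q (translate_hits K (x i)))"
\<comment> \<open>The product rule for independent variables is stated for nonempty index
  sets.\<close>
proof (cases "J = {}")
  case False
  interpret Q: prob_space Q by (rule prob_space_Q)
  define A where "A i = space closed_sets_space - translate_hits K (x i)" for i
  have A: "A i \<in> sets closed_sets_space" for i
    unfolding A_def using translate_hits_sets[OF K] by auto
  have "{w \<in> space M. \<forall>i\<in>J. (+) (x i) ` G i w \<inter> K = {}} = (\<Inter>i\<in>J. G i -` A i \<inter> space M)"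
  proof -
    have "(+) (x i) ` G i w \<inter> K = {} \<longleftrightarrow> G i w \<in> A i" if "w \<in> space M" for i w
      using that by (simp add: A_def grain_hits_iff space_closed_sets_space grain_closed)
    then have "{w \<in> space M. \<forall>i\<in>J. (+) (x i) ` G i w \<inter> K = {}} = {w \<in> space M. \<forall>i\<in>J. G i w \<in> A i}"
      by (intro Collect_cong conj_cong refl ball_cong)
    also have "\<dots> = (\<Inter>i\<in>J. G i -` A i \<inter> space M)" using False by blast
    finally show ?thesis .
  qed
  then have "prob {w \<in> space M. \<forall>i\<in>J. (+) (x i) ` G i w \<inter> K = {}} = (\<Prod>i\<in>J. prob (G i -` A i \<inter> space M))"
    using indep_varsD[OF grains_independent False J _ A] by simp
  also have "\<dots> = (\<Prod>i\<in>J. measure Q (A i))"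
    using measure_distr[OF grain_measurable A] by (simp only: grain_distribution)
  also have "\<dots> = (\<Prod>i\<in>J. 1 - measure Q (translate_hits K (x i)))"
    using translate_hits_sets[OF K] sets_eq_imp_space_eq[OF sets_Q]
    by (intro prod.cong refl) (simp add: A_def Q.prob_compl[symmetric])
  finally show ?thesis .
qed (simp add: prob_space)

text \<open>This and \<open>grain_space\<close> name the two spaces in
  \<open>grains_independent_of_germs\<close>, so that the assumption can be folded into
  them.\<close>

definition germ_space :: "(enat \<times> (nat \<Rightarrow> 'a)) measure" where
  "germ_space = count_space UNIV \<Otimes>\<^sub>M (\<Pi>\<^sub>M i\<in>UNIV. borel)"

definition grain_space :: "(nat \<Rightarrow> 'a set) measure" where
  "grain_space = (\<Pi>\<^sub>M i\<in>UNIV. closed_sets_space)"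

lemma measurable_germs: "(\<lambda>w. (N w, \<lambda>i. X i w)) \<in> M \<rightarrow>\<^sub>M germ_space"
  unfolding germ_space_def
  by (intro measurable_Pair number_measurable measurable_PiM_single') (auto simp: germ_measurable)

lemma measurable_grains: "(\<lambda>w i. G i w) \<in> M \<rightarrow>\<^sub>M grain_space"
  unfolding grain_space_def
  using measurable_space[OF grain_measurable]
  by (intro measurable_PiM_single') (auto simp: grain_measurable PiE_iff)

text \<open>By independence the joint law of germs and grains is a product. Fubini freezes the
  germs, and at deterministic positions \<open>prob_grains_miss\<close> gives the product.\<close>

lemma prob_miss_finitely_many:
  assumes K: "compact K"
  shows "prob {w \<in> space M. \<forall>i<n. enat i < N w \<longrightarrow> (+) (X i w) ` G i w \<inter> K = {}}
    = (\<integral>w. (\<Prod>i<n. if enat i < N w then 1 - measure Q (translate_hits K (X i w)) else 1) \<partial>M)"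
proof -
  interpret Q: prob_space Q by (rule prob_space_Q)
  let ?U = "\<lambda>w. (N w, \<lambda>i. X i w)" and ?V = "\<lambda>w i. G i w"
  define E where "E = {z \<in> space (germ_space \<Otimes>\<^sub>M grain_space).
    \<forall>i<n. enat i < fst (fst z) \<longrightarrow> snd z i \<notin> translate_hits K (snd (fst z) i)}"
  define c where "c u = (\<Prod>i<n. if enat i < fst u then 1 - measure Q (translate_hits K (snd u i)) else 1)"
    for u :: "enat \<times> (nat \<Rightarrow> 'a)"
  have [measurable]: "(\<lambda>z. fst (fst z)) \<in> germ_space \<Otimes>\<^sub>M grain_space \<rightarrow>\<^sub>M count_space UNIV"
    "(\<lambda>z. snd (fst z) i) \<in> germ_space \<Otimes>\<^sub>M grain_space \<rightarrow>\<^sub>M borel"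
    "(\<lambda>z. snd z i) \<in> germ_space \<Otimes>\<^sub>M grain_space \<rightarrow>\<^sub>M closed_sets_space" for i
    unfolding germ_space_def grain_space_def by measurable
  have [measurable]: "Measurable.pred (germ_space \<Otimes>\<^sub>M grain_space)
      (\<lambda>z. snd z i \<in> translate_hits K (snd (fst z) i))" for i
  proof -
    have "(\<lambda>z. (snd (fst z) i, snd z i)) \<in> germ_space \<Otimes>\<^sub>M grain_space \<rightarrow>\<^sub>M borel \<Otimes>\<^sub>M closed_sets_space"
      by measurable
    from measurable_sets[OF this translate_hits_measurable[OF K]]
    show ?thesis by (simp add: pred_def vimage_def Int_def conj_commute)
  qed
  have E: "E \<in> sets (germ_space \<Otimes>\<^sub>M grain_space)" unfolding E_def by measurable
  have c [measurable]: "c \<in> borel_measurable germ_space"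
  proof -
    have [measurable]: "fst \<in> germ_space \<rightarrow>\<^sub>M count_space UNIV"
      "(\<lambda>u. snd u i) \<in> germ_space \<rightarrow>\<^sub>M borel" for i
      unfolding germ_space_def by measurable
    note measurable_hit_probability[OF K, measurable]
    show ?thesis unfolding c_def by measurable
  qed
  have c_bounds: "0 \<le> c u" "c u \<le> 1" for u
    unfolding c_def by (auto intro!: prod_nonneg prod_le_1)
  interpret V: prob_space "distr M grain_space ?V"
    by (rule prob_space_distr[OF measurable_grains])
  \<comment> \<open>The section of \<open>E\<close> at \<open>u\<close> is the event that grains at
    the fixed positions \<open>snd u i\<close> miss \<open>K\<close>; indices beyond the number of
    germs contribute the factor 1 to \<open>c u\<close>.\<close>
  have sec: "emeasure (distr M grain_space ?V) (Pair u -` E) = ennreal (c u)" if u: "u \<in> space germ_space" for u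
  proof -
    have "emeasure (distr M grain_space ?V) (Pair u -` E) = emeasure M (?V -` (Pair u -` E) \<inter> space M)"
      using sets_Pair1[OF E] by (intro emeasure_distr measurable_grains)
    also have "?V -` (Pair u -` E) \<inter> space M
      = {w \<in> space M. \<forall>i\<in>{i. i < n \<and> enat i < fst u}. (+) (snd u i) ` G i w \<inter> K = {}}"
    proof -
      have "?V -` (Pair u -` E) \<inter> space M = {w \<in> space M. \<forall>i<n. enat i < fst u \<longrightarrow> G i w \<notin> translate_hits K (snd u i)}"
        using u measurable_space[OF measurable_grains] by (auto simp: E_def space_pair_measure)
      also have "\<dots> = {w \<in> space M. \<forall>i<n. enat i < fst u \<longrightarrow> (+) (snd u i) ` G i w \<inter> K = {}}"
        by (intro Collect_cong conj_cong refl) (simp add: grain_hits_iff)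
      finally show ?thesis by (simp add: imp_conjL)
    qed
    also have "emeasure M \<dots> = ennreal (\<Prod>i\<in>{i. i < n \<and> enat i < fst u}. 1 - measure Q (translate_hits K (snd u i)))"
      using prob_grains_miss[OF K, of "{i. i < n \<and> enat i < fst u}" "snd u"]
      by (simp add: emeasure_eq_measure)
    also have "(\<Prod>i\<in>{i. i < n \<and> enat i < fst u}. 1 - measure Q (translate_hits K (snd u i))) = c u"
      unfolding c_def by (subst prod.If_cases) (auto intro!: prod.cong simp: Int_def)
    finally show ?thesis .
  qed
  have meas_UV: "(\<lambda>w. (?U w, ?V w)) \<in> M \<rightarrow>\<^sub>M germ_space \<Otimes>\<^sub>M grain_space"
    by (intro measurable_Pair measurable_germs measurable_grains)
  have "{w \<in> space M. \<forall>i<n. enat i < N w \<longrightarrow> (+) (X i w) ` G i w \<inter> K = {}}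
    = (\<lambda>w. (?U w, ?V w)) -` E \<inter> space M"
  proof -
    have "(\<lambda>w. (?U w, ?V w)) -` E \<inter> space M
      = {w \<in> space M. \<forall>i<n. enat i < N w \<longrightarrow> G i w \<notin> translate_hits K (X i w)}"
      using measurable_space[OF meas_UV] by (auto simp: E_def)
    also have "\<dots> = {w \<in> space M. \<forall>i<n. enat i < N w \<longrightarrow> (+) (X i w) ` G i w \<inter> K = {}}"
      by (intro Collect_cong conj_cong refl) (simp add: grain_hits_iff)
    finally show ?thesis by simp
  qed
  then have "emeasure M {w \<in> space M. \<forall>i<n. enat i < N w \<longrightarrow> (+) (X i w) ` G i w \<inter> K = {}}
    = emeasure (distr M (germ_space \<Otimes>\<^sub>M grain_space) (\<lambda>w. (?U w, ?V w))) E"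
    by (simp add: emeasure_distr[OF meas_UV E])
  also have "\<dots> = emeasure (distr M germ_space ?U \<Otimes>\<^sub>M distr M grain_space ?V) E"
    unfolding distr_Pair_indep_set[OF measurable_germs measurable_grains
      grains_independent_of_germs[folded germ_space_def grain_space_def]] ..
  also have "\<dots> = (\<integral>\<^sup>+ u. emeasure (distr M grain_space ?V) (Pair u -` E) \<partial>distr M germ_space ?U)"
    using E by (intro V.emeasure_pair_measure_alt) (simp cong: sets_pair_measure_cong)
  also have "\<dots> = (\<integral>\<^sup>+ u. ennreal (c u) \<partial>distr M germ_space ?U)"
    by (intro nn_integral_cong) (simp add: sec)
  also have "\<dots> = (\<integral>\<^sup>+ w. ennreal (c (?U w)) \<partial>M)"
    by (intro nn_integral_distr measurable_germs) measurable
  also have "\<dots> = ennreal (\<integral>w. c (?U w) \<partial>M)"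
    using measurable_compose[OF measurable_germs c] c_bounds
    by (intro nn_integral_eq_integral integrable_const_bound[of _ 1]) auto
  finally have "prob {w \<in> space M. \<forall>i<n. enat i < N w \<longrightarrow> (+) (X i w) ` G i w \<inter> K = {}} = (\<integral>w. c (?U w) \<partial>M)"
    using c_bounds by (simp add: emeasure_eq_measure integral_nonneg)
  then show ?thesis by (simp only: c_def fst_conv snd_conv)
qed

text \<open>Both sides are limits of the probability that the first \<open>n\<close> germs miss: the
  left by continuity from above, the right because partial sums of the hazards converge to the
  integral and \<open>enexp\<close> is continuous and bounded.\<close>

lemma prob_boolean_set_miss:
  assumes K: "compact K"
  shows "prob {w \<in> space M. boolean_set N X G w \<inter> K = {}}
    = (\<integral>w. enexp (\<integral>\<^sup>+ x. hazard Q K x \<partial>\<Phi> w) \<partial>M)"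
proof (rule LIMSEQ_unique)
  let ?A = "\<lambda>n. {w \<in> space M. \<forall>i<n. enat i < N w \<longrightarrow> (+) (X i w) ` G i w \<inter> K = {}}"
  let ?h = "\<lambda>w i. if enat i < N w then hazard Q K (X i w) else 0"
  have A: "?A n \<in> events" for n
  proof -
    have "?A n = space M - (\<Union>i<n. {w \<in> space M. enat i < N w \<and> (+) (X i w) ` G i w \<inter> K \<noteq> {}})"
      by auto
    also have "\<dots> \<in> events" using hit_event[OF K] by auto
    finally show ?thesis .
  qed
  have "(\<lambda>n. prob (?A n)) \<longlonglongrightarrow> prob (\<Inter>n. ?A n)"
  proof (rule finite_Lim_measure_decseq)
    show "range ?A \<subseteq> events" using A by blast
    show "decseq ?A"
    proof (rule decseq_SucI)
      show "?A (Suc n) \<subseteq> ?A n" for n by (intro Collect_mono) simp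
    qed
  qed
  also have "(\<Inter>n. ?A n) = {w \<in> space M. boolean_set N X G w \<inter> K = {}}"
  proof -
    define miss where "miss i w \<longleftrightarrow> (+) (X i w) ` G i w \<inter> K = {}" for i w
    have "boolean_set N X G w \<inter> K = {} \<longleftrightarrow> (\<forall>i. enat i < N w \<longrightarrow> miss i w)" for w
      using boolean_set_hits_iff[of w K] unfolding miss_def by blast
    then show ?thesis unfolding miss_def[symmetric] by blast
  qed
  finally show "(\<lambda>n. prob (?A n)) \<longlonglongrightarrow> prob {w \<in> space M. boolean_set N X G w \<inter> K = {}}" .
  have "(\<lambda>n. \<integral>w. enexp (\<Sum>i<n. ?h w i) \<partial>M) \<longlonglongrightarrow> (\<integral>w. enexp (\<integral>\<^sup>+ x. hazard Q K x \<partial>\<Phi> w) \<partial>M)"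
  proof (rule integral_dominated_convergence[where w = "\<lambda>_. 1"])
    note [measurable] = measurable_hazard[OF K] germ_measurable number_measurable
    show "(\<lambda>w. enexp (\<integral>\<^sup>+ x. hazard Q K x \<partial>\<Phi> w)) \<in> borel_measurable M"
      using measurable_nn_integral_Phi[OF measurable_hazard[OF K]] by measurable
    show "(\<lambda>w. enexp (\<Sum>i<n. ?h w i)) \<in> borel_measurable M" for n
      by measurable
    show "AE w in M. (\<lambda>n. enexp (\<Sum>i<n. ?h w i)) \<longlonglongrightarrow> enexp (\<integral>\<^sup>+ x. hazard Q K x \<partial>\<Phi> w)"
      by (intro AE_I2 tendsto_enexp) (simp add: nn_integral_germs measurable_hazard[OF K] summable_LIMSEQ)
  qed (auto simp: enexp_nonneg enexp_le_1)
  moreover have "(\<integral>w. enexp (\<Sum>i<n. ?h w i) \<partial>M) = prob (?A n)" for n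
    unfolding prob_miss_finitely_many[OF K] enexp_sum
    by (intro Bochner_Integration.integral_cong prod.cong refl) (simp add: enexp_hazard)
  ultimately show "(\<lambda>n. prob (?A n)) \<longlonglongrightarrow> (\<integral>w. enexp (\<integral>\<^sup>+ x. hazard Q K x \<partial>\<Phi> w) \<partial>M)"
    by (simp only:)
qed

end

section \<open>Comparison of Boolean models\<close>

context boolean_model
begin

lemma avoidance_probability_eq:
  assumes B: "B \<in> sets borel" "bounded B"
  shows "avoidance_probability M (boolean_set N X G) B
    = 1 - measure (completion M) {w \<in> space M. boolean_set N X G w \<inter> B \<noteq> {}}"
proof -
  interpret C: prob_space "completion M" by (rule prob_space_completion)
  have "{w \<in> space M. boolean_set N X G w \<inter> B = {}}
    = space (completion M) - {w \<in> space M. boolean_set N X G w \<inter> B \<noteq> {}}" by auto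
  then show ?thesis
    unfolding avoidance_probability_def
    using C.prob_compl[OF hitting_completion(1)[OF AE_closed_boolean_set boolean_set_hit_event B]] by (simp only:)
qed

lemma avoidance_probability_compact:
  assumes K: "compact K"
  shows "avoidance_probability M (boolean_set N X G) K = prob {w \<in> space M. boolean_set N X G w \<inter> K = {}}"
proof -
  have "{w \<in> space M. boolean_set N X G w \<inter> K = {}} = space M - {w \<in> space M. boolean_set N X G w \<inter> K \<noteq> {}}"
    by blast
  then have "{w \<in> space M. boolean_set N X G w \<inter> K = {}} \<in> events"
    using boolean_set_hit_event[OF K] by simp
  then show ?thesis by (simp add: avoidance_probability_def)
qed

lemma avoidance_probability_antimono:
  assumes "K \<in> sets borel" "bounded K" "B \<in> sets borel" "bounded B" "K \<subseteq> B"
  shows "avoidance_probability M (boolean_set N X G) B \<le> avoidance_probability M (boolean_set N X G) K"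
proof -
  interpret C: prob_space "completion M" by (rule prob_space_completion)
  have "C.prob {w \<in> space M. boolean_set N X G w \<inter> K \<noteq> {}} \<le> C.prob {w \<in> space M. boolean_set N X G w \<inter> B \<noteq> {}}"
    using assms hitting_completion(1)[OF AE_closed_boolean_set boolean_set_hit_event]
    by (intro C.finite_measure_mono) blast+
  then show ?thesis using assms by (simp only: avoidance_probability_eq)
qed

text \<open>The complement of the capacitability statement: approximating the hitting probability
  from below approximates the avoidance probability from above.\<close>

lemma avoidance_probability_inner_approx:
  assumes B: "B \<in> sets borel" "bounded B" and e: "0 < e"
  shows "\<exists>K. compact K \<and> K \<subseteq> B \<and>
    avoidance_probability M (boolean_set N X G) K \<le> avoidance_probability M (boolean_set N X G) B + e"
proof -
  let ?H = "\<lambda>A. {w \<in> space M. boolean_set N X G w \<inter> A \<noteq> {}}"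
  obtain K where K: "compact K" "K \<subseteq> B" "measure (completion M) (?H B) \<le> prob (?H K) + e"
    using hitting_completion(2)[OF AE_closed_boolean_set boolean_set_hit_event B e] by blast
  have "measure (completion M) (?H K) = prob (?H K)"
    using boolean_set_hit_event[OF K(1)] by (rule measure_completion)
  with K(3) have "avoidance_probability M (boolean_set N X G) K \<le> avoidance_probability M (boolean_set N X G) B + e"
    unfolding avoidance_probability_eq[OF B]
      avoidance_probability_eq[OF borel_compact[OF K(1)] compact_imp_bounded[OF K(1)]]
    by linarith
  with K show ?thesis by blast
qed

lemma avoidance_probability_laplace:
  assumes "compact K"
  shows "avoidance_probability M (boolean_set N X G) K = (\<integral>w. enexp (\<integral>\<^sup>+ x. hazard Q K x \<partial>\<Phi> w) \<partial>M)"
  using assms by (simp only: avoidance_probability_compact prob_boolean_set_miss)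

text \<open>For a deterministic grain the hazard is \<open>top\<close> on \<open>K - G0\<close> and
  \<open>0\<close> elsewhere. Its integral is thus \<open>0\<close> or \<open>top\<close>, and
  \<open>enexp\<close> of it is the indicator of the void event.\<close>

lemma avoidance_probability_fixed_grain:
  assumes Q: "Q = return closed_sets_space G0" and G0: "compact G0" and K: "compact K"
  shows "avoidance_probability M (boolean_set N X G) K
    = void_probability M \<Phi> ((\<lambda>(k, g). k - g) ` (K \<times> G0))"
proof -
  define D where "D = (\<lambda>(k, g). k - g) ` (K \<times> G0)"
  have D_eq: "x \<in> D \<longleftrightarrow> G0 \<in> translate_hits K x" for x
  proof
    assume "x \<in> D"
    then obtain k g where "x = k - g" "k \<in> K" "g \<in> G0" by (auto simp: D_def)
    then have "x + g \<in> (+) x ` G0 \<inter> K" by simp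
    then show "G0 \<in> translate_hits K x"
      using compact_imp_closed[OF G0] unfolding translate_hits_def by blast
  next
    assume "G0 \<in> translate_hits K x"
    then obtain g where g: "g \<in> G0" "x + g \<in> K" by (auto simp: translate_hits_def)
    have "x = (\<lambda>(k, g). k - g) (x + g, g)" by simp
    then show "x \<in> D" unfolding D_def using g by (intro image_eqI) auto
  qed
  have "compact D"
    unfolding D_def split_def using G0 K
    by (intro compact_continuous_image compact_Times continuous_intros)
  then have D: "D \<in> sets borel" by (rule borel_compact)
  have hazard: "hazard Q K x = top * indicator D x" for x
    by (simp add: hazard_def Q measure_return[OF translate_hits_sets[OF K]] indicator_def D_eq)
  have "avoidance_probability M (boolean_set N X G) K = (\<integral>w. indicator {w \<in> space M. emeasure (\<Phi> w) D = 0} w \<partial>M)"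
    unfolding avoidance_probability_laplace[OF K]
  proof (intro Bochner_Integration.integral_cong refl)
    fix w assume w: "w \<in> space M"
    have "(\<integral>\<^sup>+ x. hazard Q K x \<partial>\<Phi> w) = top * emeasure (\<Phi> w) D"
      unfolding hazard using D by (intro nn_integral_cmult_indicator) (simp add: sets_Phi[OF w])
    then show "enexp (\<integral>\<^sup>+ x. hazard Q K x \<partial>\<Phi> w) = indicator {w \<in> space M. emeasure (\<Phi> w) D = 0} w"
      using w by (cases "emeasure (\<Phi> w) D = 0") (simp_all add: enexp_def ennreal_top_mult)
  qed
  also have "\<dots> = prob {w \<in> space M. emeasure (\<Phi> w) D = 0}"
    by (simp add: Int_def conj_commute)
  finally show ?thesis by (simp add: void_probability_def D_def)
qed

end

text \<open>A compact \<open>K \<subseteq> B\<close> is chosen to be nearly optimal for the second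
  model; for the first model, shrinking \<open>B\<close> to \<open>K\<close> only increases the
  avoidance probability.\<close>

lemma avoidance_probability_le:
  assumes C1: "boolean_model M1 \<Phi>1 Q1 N1 X1 G1" and C2: "boolean_model M2 \<Phi>2 Q2 N2 X2 G2"
    and le: "\<And>K. compact K \<Longrightarrow> avoidance_probability M1 (boolean_set N1 X1 G1) K
      \<le> avoidance_probability M2 (boolean_set N2 X2 G2) K"
    and B: "B \<in> sets borel" "bounded B"
  shows "avoidance_probability M1 (boolean_set N1 X1 G1) B \<le> avoidance_probability M2 (boolean_set N2 X2 G2) B"
proof (rule field_le_epsilon)
  interpret C1: boolean_model M1 \<Phi>1 Q1 N1 X1 G1 by (rule C1)
  interpret C2: boolean_model M2 \<Phi>2 Q2 N2 X2 G2 by (rule C2)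
  fix e :: real assume "0 < e"
  then obtain K where K: "compact K" "K \<subseteq> B" "avoidance_probability M2 (boolean_set N2 X2 G2) K
      \<le> avoidance_probability M2 (boolean_set N2 X2 G2) B + e"
    using C2.avoidance_probability_inner_approx[OF B] by blast
  have "avoidance_probability M1 (boolean_set N1 X1 G1) B \<le> avoidance_probability M1 (boolean_set N1 X1 G1) K"
    by (rule C1.avoidance_probability_antimono[OF borel_compact[OF K(1)] compact_imp_bounded[OF K(1)] B K(2)])
  also note le[OF K(1)]
  also note K(3)
  finally show "avoidance_probability M1 (boolean_set N1 X1 G1) B
    \<le> avoidance_probability M2 (boolean_set N2 X2 G2) B + e" .
qed

theorem proposition3p4:
  fixes M1 :: "'v measure" and M2 :: "'w measure"
    and \<Phi>1 :: "'v \<Rightarrow> 'a::euclidean_space measure" and \<Phi>2 :: "'w \<Rightarrow> 'a measure"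
    and Q :: "'a set measure"
  assumes "boolean_model M1 \<Phi>1 Q N1 X1 G1" and "boolean_model M2 \<Phi>2 Q N2 X2 G2"
    and "simple_point_process M1 \<Phi>1" and "simple_point_process M2 \<Phi>2"
    and "locally_finite_moment_measures M1 \<Phi>1" and "locally_finite_moment_measures M2 \<Phi>2"
  shows "(dcx_le M1 \<Phi>1 M2 \<Phi>2 \<longrightarrow>
            (\<forall>B\<in>sets borel. bounded B \<longrightarrow>
               avoidance_probability M1 (boolean_set N1 X1 G1) B
                 \<le> avoidance_probability M2 (boolean_set N2 X2 G2) B)) \<and>
         (\<forall>G0. compact G0 \<and> Q = return closed_sets_space G0 \<and>
            (\<forall>B\<in>sets borel. bounded B \<longrightarrow> void_probability M1 \<Phi>1 B \<le> void_probability M2 \<Phi>2 B) \<longrightarrow>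
            (\<forall>B\<in>sets borel. bounded B \<longrightarrow>
               avoidance_probability M1 (boolean_set N1 X1 G1) B
                 \<le> avoidance_probability M2 (boolean_set N2 X2 G2) B))"
proof -
  interpret C1: boolean_model M1 \<Phi>1 Q N1 X1 G1 by fact
  interpret C2: boolean_model M2 \<Phi>2 Q N2 X2 G2 by fact
  note le = avoidance_probability_le[OF assms(1,2)]
  show ?thesis
  proof (intro conjI impI allI ballI; (elim conjE)?)
    fix B :: "'a set" assume B: "B \<in> sets borel" "bounded B" and dcx: "dcx_le M1 \<Phi>1 M2 \<Phi>2"
    show "avoidance_probability M1 (boolean_set N1 X1 G1) B \<le> avoidance_probability M2 (boolean_set N2 X2 G2) B"
    proof (rule le[OF _ B])
      fix K :: "'a set" assume K: "compact K"
      show "avoidance_probability M1 (boolean_set N1 X1 G1) K \<le> avoidance_probability M2 (boolean_set N2 X2 G2) K"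
        \<comment> \<open>The common grain law \<open>Q\<close> produces the same function
          \<open>hazard Q K\<close> for both models.\<close>
        unfolding C1.avoidance_probability_laplace[OF K] C2.avoidance_probability_laplace[OF K]
        by (rule dcx_le_laplace[OF C1.point_process_axioms C2.point_process_axioms dcx C1.measurable_hazard[OF K]])
    qed
  next
    fix G0 B :: "'a set"
    assume G0: "compact G0" "Q = return closed_sets_space G0" and B: "B \<in> sets borel" "bounded B"
      and void: "\<forall>B\<in>sets borel. bounded B \<longrightarrow> void_probability M1 \<Phi>1 B \<le> void_probability M2 \<Phi>2 B"
    show "avoidance_probability M1 (boolean_set N1 X1 G1) B \<le> avoidance_probability M2 (boolean_set N2 X2 G2) B"
    proof (rule le[OF _ B])
      fix K :: "'a set" assume K: "compact K"
      \<comment> \<open>The set \<open>K - G0\<close> is the same for both models, and its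
        compactness makes it one of the bounded Borel sets to which the assumption on void
        probabilities applies.\<close>
      let ?D = "(\<lambda>(k, g). k - g) ` (K \<times> G0)"
      have "compact ?D"
        unfolding split_def using G0(1) K
        by (intro compact_continuous_image compact_Times continuous_intros)
      then have "void_probability M1 \<Phi>1 ?D \<le> void_probability M2 \<Phi>2 ?D"
        using void borel_compact compact_imp_bounded by blast
      then show "avoidance_probability M1 (boolean_set N1 X1 G1) K \<le> avoidance_probability M2 (boolean_set N2 X2 G2) K"
        by (simp only: C1.avoidance_probability_fixed_grain[OF G0(2,1) K]
            C2.avoidance_probability_fixed_grain[OF G0(2,1) K])
    qed
  qed
qed

end
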